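(* Let $P$ and $R$ be two general logic programs such that $P\cup R$ is well-moded and $P$ extends $R$, and let $M$ be a complete model of $P\cup R$. Suppose that (1) $P$ is acceptable with respect to a moded level mapping $|\ |$ and $M$; (2) for all well-moded queries $Q$, all LDNF-derivations of $R\cup\{Q\}$ are finite. Then for all well-moded queries $Q$, all LDNF-derivations of $(P\cup R)\cup\{Q\}$ are finite.
   Context: **Programs.** All programs and queries are over a fixed first-order language with at least one constant. A literal is an atom or a negated atom. A (general) clause is $H\leftarrow L_1,\ldots,L_n$ ($n\ge 0$), $H$ an atom, $L_i$ literals. A (general) query is a finite, possibly empty, sequence of literals. A (general) program is a finite set of clauses. $B_P$ is the set of ground atoms whose predicate symbol occurs in $P$; $\mathit{ground}(P)$ is the set of ground instances of clauses of $P$. **LDNF-resolution (leftmost selection rule).** For a program $P$ and a non-empty query $Q=L,\mathbf{L}$: (i) if $L=A$ is an atom, the resolvents of $Q$ are the queries $(\mathbf{B},\mathbf{L})\theta$ for $H\leftarrow\mathbf{B}$ a variant of a clause of $P$ renamed apart from $Q$ and $\theta=\mathrm{mgu}(A,H)$; (ii) if $L=\neg A$ with $A$ ground, a subsidiary LDNF-tree for $P\cup\{A\}$ is constructed; if this tree is finite and finitely failed, $Q$ has the single resolvent $\mathbf{L}$; if it is finite and has a successful branch, $Q$ fails; if its construction diverges, the derivation containing $Q$ is considered infinite; (iii) if $L=\neg A$ with $A$ non-ground, the derivation flounders: it ends (finitely) with no resolvent. A branch is successful if it ends in the empty query; it is failed if it ends in a query whose first literal is positive with no resolvent, or negative and ground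 with a finite subsidiary tree having a successful branch. A tree is finitely failed if it is finite and all its branches are failed. The branches of the LDNF-tree of $P\cup\{Q\}$ are its LDNF-derivations. "All LDNF-derivations of $P\cup\{Q\}$ are finite" means that the interpreter terminates: there is no infinite sequence $Q=Q_0,Q_1,Q_2,\ldots$ where each $Q_{k+1}$ is a resolvent of $Q_k$ or, if $Q_k$ begins with a ground negative literal $\neg A$, the root $A$ of its subsidiary tree. **Modes.** A mode for an $n$-ary predicate $p$ is a function $m_p:\{1,\ldots,n\}\to\{+,-\}$; $i$ is an input position if $m_p(i)=+$ and an output position if $m_p(i)=-$. Every predicate symbol has a fixed unique mode. A literal (positive or negative) is written $p(\mathbf{s},\mathbf{t})$ with $\mathbf{s}$ the terms in the input positions and $\mathbf{t}$ those in the output positions. A query $p_1(\mathbf{s}_1,\mathbf{t}_1),\ldots,p_n(\mathbf{s}_n,\mathbf{t}_n)$ is well-moded if $\mathit{Var}(\mathbf{s}_i)\subseteq\bigcup_{j=1}^{i-1}\mathit{Var}(\mathbf{t}_j)$ for all $i\in\{1,\ldots,n\}$. A clause $p(\mathbf{t}_0,\mathbf{s}_{n+1})\leftarrow p_1(\mathbf{s}_1,\mathbf{t}_1),\ldots,p_n(\mathbf{s}_n,\mathbf{t}_n)$ (where $\mathbf{t}_0$ are the input terms and $\mathbf{s}_{n+1}$ the output terms of the head) is well-moded if $\mathit{Var}(\mathbf{s}_i)\subseteq\bigcup_{j=0}^{i-1}\mathit{Var}(\mathbf{t}_j)$ for all $i\in\{1,\ldots,n+1\}$. A program is well-moded if all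 its clauses are. **Level mappings.** A level mapping for $P$ is a function $|\ |:B_P\to\mathbf{N}$, extended to ground literals by $|\neg A|=|A|$. It is a moded level mapping if $|p(\mathbf{s},\mathbf{t})|=|p(\mathbf{s},\mathbf{u})|$ for all $p$ and all (ground) $\mathbf{s},\mathbf{t},\mathbf{u}$. **Complete model.** $p$ refers to $q$ if some clause of $P$ has $p$ in its head and $q$ in its body; "depends on" is the reflexive transitive closure of "refers to". $\mathit{Neg}_P$ is the set of relations occurring in a negative literal in a clause of $P$; $\mathit{Neg}^*_P$ is the set of relations on which relations in $\mathit{Neg}_P$ depend; $P^-$ is the set of clauses of $P$ defining relations in $\mathit{Neg}^*_P$. A model $M$ of $P$ is complete if its restriction to the relations in $\mathit{Neg}^*_P$ is a model of Clark's completion $\mathit{comp}(P^-)$ (with the free equality axioms; a relation in $\mathit{Neg}^*_P$ having no clauses is completed by $\forall \mathbf{x}\,\neg p(\mathbf{x})$). **Acceptability.** Let $|\ |$ be a level mapping for $P$ and $M$ a complete model (here: of the whole program $P\cup R$). $P$ is acceptable w.r.t. $|\ |$ and $M$ if for every clause $A\leftarrow\mathbf{A},B,\mathbf{B}$ in $\mathit{ground}(P)$ (with $B$ a literal and $\mathbf{A},\mathbf{B}$ sequences of literals): if $M\models\mathbf{A}$ then $|A|>|B|$. **Extension.** A relation is defined in $P$ if it occurs in the head of a clause of $P$. $P$ extends $R$ if no relation defined in $P$ occurs in $R$. *)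

theory Defs
  imports Main
begin

section \<open>Syntax\<close>

text \<open>The function and relation symbols of the language are the elements of \<open>'f\<close> and \<open>'r\<close>;
  the arities are enforced by the \<open>wf_\<close> predicates below.\<close>

record ('f, 'r) language =
  fun_arity :: "'f \<Rightarrow> nat"
  rel_arity :: "'r \<Rightarrow> nat"

definition has_constant :: "('f, 'r) language \<Rightarrow> bool" where
  "has_constant \<L> \<longleftrightarrow> (\<exists>c. fun_arity \<L> c = 0)"

datatype 'f trm = Var nat | Fun 'f "'f trm list"
datatype ('f, 'r) atom = Atom (rel: 'r) (args: "'f trm list")
datatype ('f, 'r) literal = Pos (atom_of: "('f, 'r) atom") | Neg (atom_of: "('f, 'r) atom")
type_synonym ('f, 'r) query = "('f, 'r) literal list"
datatype ('f, 'r) clause = Clause (head: "('f, 'r) atom") (body: "('f, 'r) query")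
type_synonym ('f, 'r) program = "('f, 'r) clause set"

primrec wf_trm :: "('f, 'r) language \<Rightarrow> 'f trm \<Rightarrow> bool" where
  "wf_trm \<L> (Var x) \<longleftrightarrow> True"
| "wf_trm \<L> (Fun f ts) \<longleftrightarrow> length ts = fun_arity \<L> f \<and> list_all (wf_trm \<L>) ts"

definition wf_atom :: "('f, 'r) language \<Rightarrow> ('f, 'r) atom \<Rightarrow> bool" where
  "wf_atom \<L> A \<longleftrightarrow> length (args A) = rel_arity \<L> (rel A) \<and> (\<forall>t\<in>set (args A). wf_trm \<L> t)"

definition wf_query :: "('f, 'r) language \<Rightarrow> ('f, 'r) query \<Rightarrow> bool" where
  "wf_query \<L> Q \<longleftrightarrow> (\<forall>l\<in>set Q. wf_atom \<L> (atom_of l))"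

definition wf_clause :: "('f, 'r) language \<Rightarrow> ('f, 'r) clause \<Rightarrow> bool" where
  "wf_clause \<L> c \<longleftrightarrow> wf_atom \<L> (head c) \<and> wf_query \<L> (body c)"

definition general_program :: "('f, 'r) language \<Rightarrow> ('f, 'r) program \<Rightarrow> bool" where
  "general_program \<L> P \<longleftrightarrow> finite P \<and> (\<forall>c\<in>P. wf_clause \<L> c)"

primrec trm_vars :: "'f trm \<Rightarrow> nat set" where
  "trm_vars (Var x) = {x}"
| "trm_vars (Fun f ts) = \<Union> (set (map trm_vars ts))"

definition atom_vars :: "('f, 'r) atom \<Rightarrow> nat set" where
  "atom_vars A = \<Union> (trm_vars ` set (args A))"

definition query_vars :: "('f, 'r) query \<Rightarrow> nat set" where
  "query_vars Q = (\<Union>l\<in>set Q. atom_vars (atom_of l))"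

definition clause_vars :: "('f, 'r) clause \<Rightarrow> nat set" where
  "clause_vars c = atom_vars (head c) \<union> query_vars (body c)"

definition ground_atom :: "('f, 'r) atom \<Rightarrow> bool" where
  "ground_atom A \<longleftrightarrow> atom_vars A = {}"

definition clause_rels :: "('f, 'r) clause \<Rightarrow> 'r set" where
  "clause_rels c = insert (rel (head c)) ((\<lambda>l. rel (atom_of l)) ` set (body c))"

definition rels :: "('f, 'r) program \<Rightarrow> 'r set" where
  "rels P = (\<Union>c\<in>P. clause_rels c)"

definition defined_rels :: "('f, 'r) program \<Rightarrow> 'r set" where
  "defined_rels P = (\<lambda>c. rel (head c)) ` P"

definition extends :: "('f, 'r) program \<Rightarrow> ('f, 'r) program \<Rightarrow> bool" where
  "extends P R \<longleftrightarrow> defined_rels P \<inter> rels R = {}"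

section \<open>Substitutions\<close>

type_synonym 'f subst = "nat \<Rightarrow> 'f trm"

primrec subst_trm :: "'f trm \<Rightarrow> 'f subst \<Rightarrow> 'f trm" where
  "subst_trm (Var x) \<sigma> = \<sigma> x"
| "subst_trm (Fun f ts) \<sigma> = Fun f (map (\<lambda>t. subst_trm t \<sigma>) ts)"

definition subst_atom :: "('f, 'r) atom \<Rightarrow> 'f subst \<Rightarrow> ('f, 'r) atom" where
  "subst_atom A \<sigma> = Atom (rel A) (map (\<lambda>t. subst_trm t \<sigma>) (args A))"

primrec subst_literal :: "('f, 'r) literal \<Rightarrow> 'f subst \<Rightarrow> ('f, 'r) literal" where
  "subst_literal (Pos A) \<sigma> = Pos (subst_atom A \<sigma>)"
| "subst_literal (Neg A) \<sigma> = Neg (subst_atom A \<sigma>)"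

definition subst_query :: "('f, 'r) query \<Rightarrow> 'f subst \<Rightarrow> ('f, 'r) query" where
  "subst_query Q \<sigma> = map (\<lambda>l. subst_literal l \<sigma>) Q"

definition subst_clause :: "('f, 'r) clause \<Rightarrow> 'f subst \<Rightarrow> ('f, 'r) clause" where
  "subst_clause c \<sigma> = Clause (subst_atom (head c) \<sigma>) (subst_query (body c) \<sigma>)"

definition is_subst :: "('f, 'r) language \<Rightarrow> 'f subst \<Rightarrow> bool" where
  "is_subst \<L> \<sigma> \<longleftrightarrow> finite {x. \<sigma> x \<noteq> Var x} \<and> (\<forall>x. wf_trm \<L> (\<sigma> x))"

definition is_unifier :: "('f, 'r) language \<Rightarrow> 'f subst \<Rightarrow> ('f, 'r) atom \<Rightarrow> ('f, 'r) atom \<Rightarrow> bool" where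
  "is_unifier \<L> \<theta> A B \<longleftrightarrow> is_subst \<L> \<theta> \<and> subst_atom A \<theta> = subst_atom B \<theta>"

definition is_mgu :: "('f, 'r) language \<Rightarrow> 'f subst \<Rightarrow> ('f, 'r) atom \<Rightarrow> ('f, 'r) atom \<Rightarrow> bool" where
  "is_mgu \<L> \<theta> A B \<longleftrightarrow> is_unifier \<L> \<theta> A B \<and>
     (\<forall>\<sigma>. is_unifier \<L> \<sigma> A B \<longrightarrow> (\<exists>\<gamma>. is_subst \<L> \<gamma> \<and> \<sigma> = (\<lambda>x. subst_trm (\<theta> x) \<gamma>)))"

definition is_variant :: "('f, 'r) clause \<Rightarrow> ('f, 'r) clause \<Rightarrow> bool" where
  "is_variant c d \<longleftrightarrow> (\<exists>\<sigma>. d = subst_clause c \<sigma>) \<and> (\<exists>\<tau>. c = subst_clause d \<tau>)"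

definition ground_instances :: "('f, 'r) language \<Rightarrow> ('f, 'r) program \<Rightarrow> ('f, 'r) program" where
  "ground_instances \<L> P =
     {subst_clause c \<sigma> |c \<sigma>. c \<in> P \<and> is_subst \<L> \<sigma> \<and> clause_vars (subst_clause c \<sigma>) = {}}"

definition herbrand_base :: "('f, 'r) language \<Rightarrow> ('f, 'r) program \<Rightarrow> ('f, 'r) atom set" where
  "herbrand_base \<L> P = {A. wf_atom \<L> A \<and> ground_atom A \<and> rel A \<in> rels P}"

section \<open>LDNF-resolution\<close>

definition clause_resolvent ::
  "('f, 'r) language \<Rightarrow> ('f, 'r) clause \<Rightarrow> ('f, 'r) query \<Rightarrow> ('f, 'r) query \<Rightarrow> bool" where
  "clause_resolvent \<L> c Q Q' \<longleftrightarrow>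
     (\<exists>A Ls d \<theta>. Q = Pos A # Ls \<and> is_variant c d \<and> clause_vars d \<inter> query_vars Q = {} \<and>
        is_mgu \<L> \<theta> A (head d) \<and> Q' = subst_query (body d @ Ls) \<theta>)"

text \<open>Finite LDNF-trees. A node carries its query, the subsidiary tree constructed for that query
  (if any) and its children. The datatype contains only finite trees, which suffices: a subsidiary
  tree influences resolution only if it is finite, and a tree counts as infinite if the
  construction of a subsidiary tree diverges.\<close>

datatype ('f, 'r) ldnf_tree =
  Node (root: "('f, 'r) query") (subsidiary: "('f, 'r) ldnf_tree option")
    (children: "('f, 'r) ldnf_tree list")

fun has_successful_branch :: "('f, 'r) ldnf_tree \<Rightarrow> bool" where
  "has_successful_branch (Node Q S Ts) \<longleftrightarrow> Q = [] \<or> (\<exists>T\<in>set Ts. has_successful_branch T)"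

text \<open>The end of a branch is failed if its first literal is positive, or negative and ground with
  a subsidiary tree having a successful branch; an empty or floundered query is not failed.\<close>

definition failed_leaf :: "('f, 'r) query \<Rightarrow> ('f, 'r) ldnf_tree option \<Rightarrow> bool" where
  "failed_leaf Q S \<longleftrightarrow>
     (\<exists>A Ls. Q = Pos A # Ls) \<or>
     (\<exists>A Ls T. Q = Neg A # Ls \<and> ground_atom A \<and> S = Some T \<and> has_successful_branch T)"

fun finitely_failed :: "('f, 'r) ldnf_tree \<Rightarrow> bool" where
  "finitely_failed (Node Q S Ts) \<longleftrightarrow>
     (if Ts = [] then failed_leaf Q S else (\<forall>T\<in>set Ts. finitely_failed T))"

text \<open>\<open>is_ldnf_tree \<L> P T\<close>: \<open>T\<close> is a (finite) LDNF-tree of the program \<open>P\<close> and the query \<open>root T\<close>.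
  As usual, the tree contains only one resolvent for each clause that applies to the selected
  atom, since the choice of the variant and of the mgu is immaterial up to renaming. In rule
  \<open>neg_no_resolvent\<close> the query either fails, or the subsidiary tree is finite, unsuccessful and has a
  floundered branch, so that there is no resolvent either.\<close>

inductive is_ldnf_tree :: "('f, 'r) language \<Rightarrow> ('f, 'r) program \<Rightarrow> ('f, 'r) ldnf_tree \<Rightarrow> bool"
  for \<L> P where
  empty: "is_ldnf_tree \<L> P (Node [] None [])"
| pos: "\<lbrakk>distinct cs; set cs = {c \<in> P. \<exists>Q'. clause_resolvent \<L> c (Pos A # Ls) Q'};
    list_all2 (\<lambda>c T. clause_resolvent \<L> c (Pos A # Ls) (root T) \<and> is_ldnf_tree \<L> P T) cs Ts\<rbrakk>
    \<Longrightarrow> is_ldnf_tree \<L> P (Node (Pos A # Ls) None Ts)"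
| neg_resolvent: "\<lbrakk>ground_atom A; is_ldnf_tree \<L> P S; root S = [Pos A]; finitely_failed S;
    is_ldnf_tree \<L> P T; root T = Ls\<rbrakk>
    \<Longrightarrow> is_ldnf_tree \<L> P (Node (Neg A # Ls) (Some S) [T])"
| neg_no_resolvent: "\<lbrakk>ground_atom A; is_ldnf_tree \<L> P S; root S = [Pos A]; \<not> finitely_failed S\<rbrakk>
    \<Longrightarrow> is_ldnf_tree \<L> P (Node (Neg A # Ls) (Some S) [])"
| floundered: "\<not> ground_atom A \<Longrightarrow> is_ldnf_tree \<L> P (Node (Neg A # Ls) None [])"

inductive resolvent ::
  "('f, 'r) language \<Rightarrow> ('f, 'r) program \<Rightarrow> ('f, 'r) query \<Rightarrow> ('f, 'r) query \<Rightarrow> bool"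
  for \<L> P where
  pos: "\<lbrakk>c \<in> P; clause_resolvent \<L> c Q Q'\<rbrakk> \<Longrightarrow> resolvent \<L> P Q Q'"
| neg: "\<lbrakk>ground_atom A; is_ldnf_tree \<L> P S; root S = [Pos A]; finitely_failed S\<rbrakk>
    \<Longrightarrow> resolvent \<L> P (Neg A # Ls) Ls"

inductive ldnf_step ::
  "('f, 'r) language \<Rightarrow> ('f, 'r) program \<Rightarrow> ('f, 'r) query \<Rightarrow> ('f, 'r) query \<Rightarrow> bool"
  for \<L> P where
  resolve: "resolvent \<L> P Q Q' \<Longrightarrow> ldnf_step \<L> P Q Q'"
| subsidiary: "ground_atom A \<Longrightarrow> ldnf_step \<L> P (Neg A # Ls) [Pos A]"

definition all_ldnf_derivations_finite ::
  "('f, 'r) language \<Rightarrow> ('f, 'r) program \<Rightarrow> ('f, 'r) query \<Rightarrow> bool" where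
  "all_ldnf_derivations_finite \<L> P Q \<longleftrightarrow>
     \<not> (\<exists>q :: nat \<Rightarrow> ('f, 'r) query. q 0 = Q \<and> (\<forall>k. ldnf_step \<L> P (q k) (q (Suc k))))"

section \<open>Modes\<close>

datatype mode = Input | Output

text \<open>Argument positions are numbered from 0; \<open>m p i\<close> is relevant only for \<open>i\<close> below the arity
  of \<open>p\<close>.\<close>

type_synonym 'r moding = "'r \<Rightarrow> nat \<Rightarrow> mode"

definition terms_at :: "'r moding \<Rightarrow> mode \<Rightarrow> ('f, 'r) atom \<Rightarrow> 'f trm list" where
  "terms_at m d A = map ((!) (args A)) (filter (\<lambda>i. m (rel A) i = d) [0..<length (args A)])"

definition vars_at :: "'r moding \<Rightarrow> mode \<Rightarrow> ('f, 'r) atom \<Rightarrow> nat set" where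
  "vars_at m d A = \<Union> (trm_vars ` set (terms_at m d A))"

definition well_moded_query :: "'r moding \<Rightarrow> ('f, 'r) query \<Rightarrow> bool" where
  "well_moded_query m Q \<longleftrightarrow>
     (\<forall>i<length Q. vars_at m Input (atom_of (Q ! i)) \<subseteq>
        (\<Union>j<i. vars_at m Output (atom_of (Q ! j))))"

definition well_moded_clause :: "'r moding \<Rightarrow> ('f, 'r) clause \<Rightarrow> bool" where
  "well_moded_clause m c \<longleftrightarrow>
     (\<forall>i<length (body c). vars_at m Input (atom_of (body c ! i)) \<subseteq>
        vars_at m Input (head c) \<union> (\<Union>j<i. vars_at m Output (atom_of (body c ! j)))) \<and>
     vars_at m Output (head c) \<subseteq>
        vars_at m Input (head c) \<union> (\<Union>j<length (body c). vars_at m Output (atom_of (body c ! j)))"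

definition well_moded_program :: "'r moding \<Rightarrow> ('f, 'r) program \<Rightarrow> bool" where
  "well_moded_program m P \<longleftrightarrow> (\<forall>c\<in>P. well_moded_clause m c)"

text \<open>A level mapping for \<open>P\<close> is represented by a total function on atoms; only its values on
  \<open>herbrand_base \<L> P\<close> matter.\<close>

definition moded_level_mapping ::
  "('f, 'r) language \<Rightarrow> 'r moding \<Rightarrow> ('f, 'r) program \<Rightarrow> (('f, 'r) atom \<Rightarrow> nat) \<Rightarrow> bool" where
  "moded_level_mapping \<L> m P lev \<longleftrightarrow>
     (\<forall>A\<in>herbrand_base \<L> P. \<forall>B\<in>herbrand_base \<L> P.
        rel A = rel B \<and> terms_at m Input A = terms_at m Input B \<longrightarrow> lev A = lev B)"

section \<open>Models\<close>

record ('f, 'r, 'd) struct =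
  universe :: "'d set"
  fun_int :: "'f \<Rightarrow> 'd list \<Rightarrow> 'd"
  rel_int :: "'r \<Rightarrow> 'd list \<Rightarrow> bool"

definition tuples :: "('f, 'r, 'd) struct \<Rightarrow> nat \<Rightarrow> 'd list set" where
  "tuples M n = {ds. length ds = n \<and> set ds \<subseteq> universe M}"

definition is_struct :: "('f, 'r) language \<Rightarrow> ('f, 'r, 'd) struct \<Rightarrow> bool" where
  "is_struct \<L> M \<longleftrightarrow> universe M \<noteq> {} \<and>
     (\<forall>f. \<forall>ds\<in>tuples M (fun_arity \<L> f). fun_int M f ds \<in> universe M)"

definition valuations :: "('f, 'r, 'd) struct \<Rightarrow> (nat \<Rightarrow> 'd) set" where
  "valuations M = {v. \<forall>x. v x \<in> universe M}"

primrec eval_trm :: "('f, 'r, 'd) struct \<Rightarrow> (nat \<Rightarrow> 'd) \<Rightarrow> 'f trm \<Rightarrow> 'd" where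
  "eval_trm M v (Var x) = v x"
| "eval_trm M v (Fun f ts) = fun_int M f (map (eval_trm M v) ts)"

definition sat_atom :: "('f, 'r, 'd) struct \<Rightarrow> (nat \<Rightarrow> 'd) \<Rightarrow> ('f, 'r) atom \<Rightarrow> bool" where
  "sat_atom M v A \<longleftrightarrow> rel_int M (rel A) (map (eval_trm M v) (args A))"

primrec sat_literal :: "('f, 'r, 'd) struct \<Rightarrow> (nat \<Rightarrow> 'd) \<Rightarrow> ('f, 'r) literal \<Rightarrow> bool" where
  "sat_literal M v (Pos A) \<longleftrightarrow> sat_atom M v A"
| "sat_literal M v (Neg A) \<longleftrightarrow> \<not> sat_atom M v A"

definition sat_query :: "('f, 'r, 'd) struct \<Rightarrow> (nat \<Rightarrow> 'd) \<Rightarrow> ('f, 'r) query \<Rightarrow> bool" where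
  "sat_query M v Q \<longleftrightarrow> (\<forall>l\<in>set Q. sat_literal M v l)"

definition models_query :: "('f, 'r, 'd) struct \<Rightarrow> ('f, 'r) query \<Rightarrow> bool" where
  "models_query M Q \<longleftrightarrow> (\<forall>v\<in>valuations M. sat_query M v Q)"

definition is_model :: "('f, 'r) language \<Rightarrow> ('f, 'r) program \<Rightarrow> ('f, 'r, 'd) struct \<Rightarrow> bool" where
  "is_model \<L> P M \<longleftrightarrow> is_struct \<L> M \<and>
     (\<forall>c\<in>P. \<forall>v\<in>valuations M. sat_query M v (body c) \<longrightarrow> sat_atom M v (head c))"

text \<open>The free equality axioms, with equality interpreted as identity on the universe: distinct
  function symbols have disjoint ranges, functions are injective, and no variable equals a term
  properly containing it.\<close>

definition free_equality :: "('f, 'r) language \<Rightarrow> ('f, 'r, 'd) struct \<Rightarrow> bool" where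
  "free_equality \<L> M \<longleftrightarrow>
     (\<forall>f g. \<forall>ds\<in>tuples M (fun_arity \<L> f). \<forall>es\<in>tuples M (fun_arity \<L> g).
        f \<noteq> g \<longrightarrow> fun_int M f ds \<noteq> fun_int M g es) \<and>
     (\<forall>f. \<forall>ds\<in>tuples M (fun_arity \<L> f). \<forall>es\<in>tuples M (fun_arity \<L> f).
        fun_int M f ds = fun_int M f es \<longrightarrow> ds = es) \<and>
     (\<forall>t x. \<forall>v\<in>valuations M.
        wf_trm \<L> t \<and> x \<in> trm_vars t \<and> t \<noteq> Var x \<longrightarrow> v x \<noteq> eval_trm M v t)"

definition refers_to :: "('f, 'r) program \<Rightarrow> ('r \<times> 'r) set" where
  "refers_to P = {(p, q). \<exists>c\<in>P. rel (head c) = p \<and> (\<exists>l\<in>set (body c). rel (atom_of l) = q)}"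

definition depends_on :: "('f, 'r) program \<Rightarrow> ('r \<times> 'r) set" where
  "depends_on P = (refers_to P)\<^sup>*"

definition neg_rels :: "('f, 'r) program \<Rightarrow> 'r set" where
  "neg_rels P = {rel A |A c. c \<in> P \<and> Neg A \<in> set (body c)}"

definition neg_star :: "('f, 'r) program \<Rightarrow> 'r set" where
  "neg_star P = {q. \<exists>p\<in>neg_rels P. (p, q) \<in> depends_on P}"

definition neg_part :: "('f, 'r) program \<Rightarrow> ('f, 'r) program" where
  "neg_part P = {c \<in> P. rel (head c) \<in> neg_star P}"

text \<open>\<open>M\<close> satisfies the completion of the clauses \<open>P\<close> for the relations in \<open>N\<close>, that is, the free
  equality axioms and, for each \<open>p\<close> in \<open>N\<close>, the completed definition of \<open>p\<close>:
  \<open>p(x\<^sub>1,\<dots>,x\<^sub>n)\<close> holds iff, for some clause of \<open>p\<close> and some values of its variables, the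
  \<open>x\<^sub>i\<close> are equal to the arguments of the head and the body holds. For a relation without
  clauses the right-hand side is false.\<close>

definition is_model_of_completion ::
  "('f, 'r) language \<Rightarrow> 'r set \<Rightarrow> ('f, 'r) program \<Rightarrow> ('f, 'r, 'd) struct \<Rightarrow> bool" where
  "is_model_of_completion \<L> N P M \<longleftrightarrow> is_struct \<L> M \<and> free_equality \<L> M \<and>
     (\<forall>p\<in>N. \<forall>ds\<in>tuples M (rel_arity \<L> p).
        rel_int M p ds \<longleftrightarrow>
        (\<exists>c\<in>P. rel (head c) = p \<and>
           (\<exists>v\<in>valuations M. ds = map (eval_trm M v) (args (head c)) \<and> sat_query M v (body c))))"

text \<open>The bodies of the clauses in \<open>neg_part P\<close> mention only relations in \<open>neg_star P\<close>, so \<open>M\<close> need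
  not be restricted explicitly.\<close>

definition complete_model ::
  "('f, 'r) language \<Rightarrow> ('f, 'r) program \<Rightarrow> ('f, 'r, 'd) struct \<Rightarrow> bool" where
  "complete_model \<L> P M \<longleftrightarrow>
     is_model \<L> P M \<and> is_model_of_completion \<L> (neg_star P) (neg_part P) M"

definition acceptable ::
  "('f, 'r) language \<Rightarrow> ('f, 'r) program \<Rightarrow> (('f, 'r) atom \<Rightarrow> nat) \<Rightarrow> ('f, 'r, 'd) struct \<Rightarrow> bool" where
  "acceptable \<L> P lev M \<longleftrightarrow>
     (\<forall>c\<in>ground_instances \<L> P. \<forall>As B Bs.
        body c = As @ B # Bs \<and> models_query M As \<longrightarrow> lev (head c) > lev (atom_of B))"

end

(* Well-modedness is preserved by resolution, so the selected atom always has ground input terms,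
   and termination of a query reduces to termination of each selected literal: the rest of the
   query is entered only under substitutions that make the resolved part true in M.  This needs
   soundness of LDNF-resolution; for negative literals, a finitely failed tree refutes its root in M
   because M satisfies the completion on Neg*.  An atom of a relation not defined in P is resolved by
   R alone and terminates by hypothesis.  An atom of a relation defined in P has a level determined by
   its ground inputs, and induction on that level applies: after its resolution with a clause of P,
   acceptability gives every body literal a smaller level once the preceding ones are true in M. *)

theory Submission
  imports Defs
begin

section \<open>Substitution and evaluation\<close>

text \<open>The main obstacle is that \<open>M\<close> is an arbitrary structure, not a Herbrand
  model. Its completion only provides elements of the universe for which some clause body holds,
  whereas a finitely failed tree speaks about unification. The free equality axioms bridge the gap:
  a solution of term equations in \<open>M\<close> steers a run of the unification algorithm past
  both clash and occurs-check failure. A second mismatch is that the queries met during resolution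
  need not be ground, while acceptability concerns ground clauses. Truth of the resolved part is
  therefore taken as truth under all valuations, which every instance inherits, and an auxiliary
  grounding makes the level condition applicable. Termination is phrased as accessibility, and three
  inductions are nested: on the level of the atom, on the part of the clause body still to be run,
  and on the derivations of the single literal in front.\<close>

definition wf_subst :: "('f, 'r) language \<Rightarrow> 'f subst \<Rightarrow> bool" where
  "wf_subst \<L> \<sigma> \<longleftrightarrow> (\<forall>x. wf_trm \<L> (\<sigma> x))"

definition subst_comp :: "'f subst \<Rightarrow> 'f subst \<Rightarrow> 'f subst" where
  "subst_comp \<sigma> \<tau> = (\<lambda>x. subst_trm (\<sigma> x) \<tau>)"

lemma is_subst_wf_subst: "is_subst \<L> \<sigma> \<Longrightarrow> wf_subst \<L> \<sigma>"
  by (simp add: is_subst_def wf_subst_def)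

lemma subst_trm_cong:
  "(\<And>x. x \<in> trm_vars t \<Longrightarrow> \<sigma> x = \<tau> x) \<Longrightarrow> subst_trm t \<sigma> = subst_trm t \<tau>"
  by (induction t) auto

lemma subst_trm_Var [simp]: "subst_trm t Var = t"
  by (induction t) (auto intro: map_idI)

lemma subst_trm_subst_trm [simp]:
  "subst_trm (subst_trm t \<sigma>) \<tau> = subst_trm t (subst_comp \<sigma> \<tau>)"
  by (induction t) (auto simp: subst_comp_def)

lemma subst_comp_assoc: "subst_comp (subst_comp \<sigma> \<tau>) \<rho> = subst_comp \<sigma> (subst_comp \<tau> \<rho>)"
  by (rule ext) (metis subst_comp_def subst_trm_subst_trm)

lemma subst_comp_Var [simp]: "subst_comp \<sigma> Var = \<sigma>" "subst_comp Var \<sigma> = \<sigma>"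
  by (simp_all add: subst_comp_def)

lemma trm_vars_subst: "trm_vars (subst_trm t \<sigma>) = (\<Union>x\<in>trm_vars t. trm_vars (\<sigma> x))"
  by (induction t) auto

lemma finite_trm_vars [simp]: "finite (trm_vars t)"
  by (induction t) auto

lemma wf_trm_subst:
  "wf_trm \<L> t \<Longrightarrow> (\<And>x. x \<in> trm_vars t \<Longrightarrow> wf_trm \<L> (\<sigma> x)) \<Longrightarrow> wf_trm \<L> (subst_trm t \<sigma>)"
  by (induction t) (auto simp: list_all_iff)

lemma wf_subst_comp: "wf_subst \<L> \<sigma> \<Longrightarrow> wf_subst \<L> \<tau> \<Longrightarrow> wf_subst \<L> (subst_comp \<sigma> \<tau>)"
  by (simp add: wf_subst_def subst_comp_def wf_trm_subst)

lemma wf_subst_Var [simp]: "wf_subst \<L> Var"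
  by (simp add: wf_subst_def)

lemma eval_trm_subst: "eval_trm M v (subst_trm t \<sigma>) = eval_trm M (\<lambda>x. eval_trm M v (\<sigma> x)) t"
  by (induction t) (auto cong: map_cong simp: comp_def)

lemma eval_trm_cong:
  "(\<And>x. x \<in> trm_vars t \<Longrightarrow> v x = w x) \<Longrightarrow> eval_trm M v t = eval_trm M w t"
proof (induction t)
  case (Fun f ts)
  then have "map (eval_trm M v) ts = map (eval_trm M w) ts"
    by auto
  then show ?case by (simp only: eval_trm.simps)
qed simp

lemma eval_trm_in_universe:
  assumes "is_struct \<L> M" "v \<in> valuations M" "wf_trm \<L> t"
  shows "eval_trm M v t \<in> universe M"
  using assms(3)
proof (induction t)
  case (Var x)
  then show ?case using assms(2) by (simp add: valuations_def)
next
  case (Fun f ts)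
  then have "map (eval_trm M v) ts \<in> tuples M (fun_arity \<L> f)"
    by (auto simp: tuples_def list_all_iff)
  then show ?case using assms(1) by (auto simp: is_struct_def)
qed

lemma eval_subst_valuation:
  "is_struct \<L> M \<Longrightarrow> v \<in> valuations M \<Longrightarrow> wf_subst \<L> \<sigma> \<Longrightarrow> (\<lambda>x. eval_trm M v (\<sigma> x)) \<in> valuations M"
  by (simp add: valuations_def wf_subst_def eval_trm_in_universe)

lemma rel_subst_atom [simp]: "rel (subst_atom A \<sigma>) = rel A"
  by (simp add: subst_atom_def)

lemma args_subst_atom [simp]: "args (subst_atom A \<sigma>) = map (\<lambda>t. subst_trm t \<sigma>) (args A)"
  by (simp add: subst_atom_def)

lemma atom_of_subst [simp]: "atom_of (subst_literal l \<sigma>) = subst_atom (atom_of l) \<sigma>"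
  by (cases l) auto

lemma subst_atom_cong:
  "(\<And>x. x \<in> atom_vars A \<Longrightarrow> \<sigma> x = \<tau> x) \<Longrightarrow> subst_atom A \<sigma> = subst_atom A \<tau>"
  by (auto simp: subst_atom_def atom_vars_def intro!: subst_trm_cong)

lemma subst_atom_subst_atom [simp]:
  "subst_atom (subst_atom A \<sigma>) \<tau> = subst_atom A (subst_comp \<sigma> \<tau>)"
  by (simp add: subst_atom_def)

lemma subst_atom_Var [simp]: "subst_atom A Var = A"
  by (cases A) (simp add: subst_atom_def)

lemma ground_atom_subst: "ground_atom A \<Longrightarrow> subst_atom A \<sigma> = A"
  using subst_atom_cong[of A \<sigma> Var] by (simp add: ground_atom_def)

lemma atom_vars_subst: "atom_vars (subst_atom A \<sigma>) = (\<Union>x\<in>atom_vars A. trm_vars (\<sigma> x))"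
  by (auto simp: atom_vars_def trm_vars_subst)

lemma finite_atom_vars [simp]: "finite (atom_vars A)"
  by (simp add: atom_vars_def)

lemma wf_atom_subst:
  "wf_atom \<L> A \<Longrightarrow> (\<And>x. x \<in> atom_vars A \<Longrightarrow> wf_trm \<L> (\<sigma> x)) \<Longrightarrow> wf_atom \<L> (subst_atom A \<sigma>)"
  by (auto simp: wf_atom_def atom_vars_def intro!: wf_trm_subst)

lemma subst_literal_cong:
  "(\<And>x. x \<in> atom_vars (atom_of l) \<Longrightarrow> \<sigma> x = \<tau> x) \<Longrightarrow> subst_literal l \<sigma> = subst_literal l \<tau>"
  by (cases l) (auto intro: subst_atom_cong)

lemma subst_literal_subst_literal [simp]:
  "subst_literal (subst_literal l \<sigma>) \<tau> = subst_literal l (subst_comp \<sigma> \<tau>)"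
  by (cases l) auto

lemma subst_literal_eq_NegD: "subst_literal l \<sigma> = Neg A \<Longrightarrow> \<exists>B. l = Neg B \<and> rel B = rel A"
  by (cases l) auto

lemma subst_query_simps [simp]:
  "subst_query [] \<sigma> = []"
  "subst_query (l # Q) \<sigma> = subst_literal l \<sigma> # subst_query Q \<sigma>"
  "subst_query (Q @ Q') \<sigma> = subst_query Q \<sigma> @ subst_query Q' \<sigma>"
  "length (subst_query Q \<sigma>) = length Q"
  by (simp_all add: subst_query_def)

lemma set_subst_query [simp]: "set (subst_query Q \<sigma>) = (\<lambda>l. subst_literal l \<sigma>) ` set Q"
  by (simp add: subst_query_def)

lemma subst_query_cong:
  "(\<And>x. x \<in> query_vars Q \<Longrightarrow> \<sigma> x = \<tau> x) \<Longrightarrow> subst_query Q \<sigma> = subst_query Q \<tau>"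
  by (auto simp: subst_query_def query_vars_def intro!: subst_literal_cong)

lemma subst_query_subst_query [simp]:
  "subst_query (subst_query Q \<sigma>) \<tau> = subst_query Q (subst_comp \<sigma> \<tau>)"
  by (simp add: subst_query_def)

lemma subst_literal_Var [simp]: "subst_literal l Var = l"
  by (cases l) auto

lemma subst_query_Var [simp]: "subst_query Q Var = Q"
  by (simp add: subst_query_def)

lemma query_vars_subst: "query_vars (subst_query Q \<sigma>) = (\<Union>x\<in>query_vars Q. trm_vars (\<sigma> x))"
  by (auto simp: query_vars_def atom_vars_subst)

lemma query_vars_simps [simp]:
  "query_vars [] = {}"
  "query_vars (l # Q) = atom_vars (atom_of l) \<union> query_vars Q"
  "query_vars (Q @ Q') = query_vars Q \<union> query_vars Q'"
  by (auto simp: query_vars_def)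

lemma finite_query_vars [simp]: "finite (query_vars Q)"
  by (simp add: query_vars_def)

lemma wf_query_simps [simp]:
  "wf_query \<L> []"
  "wf_query \<L> (l # Q) \<longleftrightarrow> wf_atom \<L> (atom_of l) \<and> wf_query \<L> Q"
  "wf_query \<L> (Q @ Q') \<longleftrightarrow> wf_query \<L> Q \<and> wf_query \<L> Q'"
  by (auto simp: wf_query_def)

lemma wf_query_subst:
  "wf_query \<L> Q \<Longrightarrow> (\<And>x. x \<in> query_vars Q \<Longrightarrow> wf_trm \<L> (\<sigma> x)) \<Longrightarrow> wf_query \<L> (subst_query Q \<sigma>)"
  by (auto simp: wf_query_def query_vars_def intro!: wf_atom_subst)

lemma subst_clause_sel [simp]:
  "head (subst_clause c \<sigma>) = subst_atom (head c) \<sigma>"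
  "body (subst_clause c \<sigma>) = subst_query (body c) \<sigma>"
  by (simp_all add: subst_clause_def)

lemma subst_clause_cong:
  "(\<And>x. x \<in> clause_vars c \<Longrightarrow> \<sigma> x = \<tau> x) \<Longrightarrow> subst_clause c \<sigma> = subst_clause c \<tau>"
  by (auto simp: subst_clause_def clause_vars_def intro!: subst_atom_cong subst_query_cong)

lemma subst_clause_subst_clause [simp]:
  "subst_clause (subst_clause c \<sigma>) \<tau> = subst_clause c (subst_comp \<sigma> \<tau>)"
  by (simp add: subst_clause_def)

lemma subst_clause_Var [simp]: "subst_clause c Var = c"
  by (cases c) (simp add: subst_clause_def)

lemma clause_vars_subst:
  "clause_vars (subst_clause c \<sigma>) = (\<Union>x\<in>clause_vars c. trm_vars (\<sigma> x))"
  by (auto simp: clause_vars_def atom_vars_subst query_vars_subst)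

lemma finite_clause_vars [simp]: "finite (clause_vars c)"
  by (simp add: clause_vars_def)

section \<open>Variants of clauses\<close>

lemma subst_trm_eq_identD: "subst_trm t \<sigma> = t \<Longrightarrow> x \<in> trm_vars t \<Longrightarrow> \<sigma> x = Var x"
proof (induction t)
  case (Fun f ts)
  then have "map (\<lambda>t. subst_trm t \<sigma>) ts = map (\<lambda>t. t) ts"
    by simp
  then have "\<forall>t\<in>set ts. subst_trm t \<sigma> = t"
    by (simp only: map_eq_conv)
  then show ?case using Fun by auto
qed simp

lemma subst_clause_eq_identD:
  assumes "subst_clause c \<sigma> = c" "x \<in> clause_vars c"
  shows "\<sigma> x = Var x"
proof -
  have *: "\<sigma> x = Var x" if "subst_atom A \<sigma> = A" "x \<in> atom_vars A" for A :: "('a, 'b) atom"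
  proof -
    have "map (\<lambda>t. subst_trm t \<sigma>) (args A) = args A"
      using that(1) by (metis args_subst_atom)
    then have "\<forall>t\<in>set (args A). subst_trm t \<sigma> = t"
      by (metis map_eq_conv map_ident)
    then show ?thesis using that(2) by (auto simp: atom_vars_def dest: subst_trm_eq_identD)
  qed
  have "subst_atom (head c) \<sigma> = head c" "subst_query (body c) \<sigma> = body c"
    using assms(1) by (metis subst_clause_sel)+
  moreover from this(2) have "\<forall>l\<in>set (body c). subst_literal l \<sigma> = l"
    unfolding subst_query_def by (metis map_eq_conv map_ident)
  then have "\<forall>l\<in>set (body c). subst_atom (atom_of l) \<sigma> = atom_of l"
    by (metis atom_of_subst)
  ultimately show ?thesis
    using assms(2) * by (auto simp: clause_vars_def query_vars_def)
qed

text \<open>The substitutions in \<open>is_variant\<close> are arbitrary and could violate arities.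
  Since they undo each other on the clause variables, they map those variables to variables;
  elsewhere the identity can replace them.\<close>

lemma is_variantE:
  assumes "is_variant c d"
  obtains \<sigma> \<tau> where "wf_subst \<L> \<sigma>" "wf_subst \<L> \<tau>" "d = subst_clause c \<sigma>" "c = subst_clause d \<tau>"
proof -
  have *: "\<exists>\<rho>. wf_subst \<L> \<rho> \<and> b = subst_clause a \<rho>"
    if ab: "b = subst_clause a \<sigma>" and ba: "a = subst_clause b \<tau>"
    for a b :: "('a, 'b) clause" and \<sigma> \<tau>
  proof -
    let ?\<rho> = "\<lambda>x. if x \<in> clause_vars a then \<sigma> x else Var x"
    have "subst_clause a (subst_comp \<sigma> \<tau>) = a"
      using ab ba by (metis subst_clause_subst_clause)
    then have "subst_trm (\<sigma> x) \<tau> = Var x" if "x \<in> clause_vars a" for x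
      using subst_clause_eq_identD[OF _ that] by (metis subst_comp_def)
    then have "\<exists>y. \<sigma> x = Var y" if "x \<in> clause_vars a" for x
      using that by (cases "\<sigma> x") fastforce+
    then have "wf_subst \<L> ?\<rho>"
      by (fastforce simp: wf_subst_def)
    moreover have "b = subst_clause a ?\<rho>"
      unfolding ab by (rule subst_clause_cong) simp
    ultimately show ?thesis by blast
  qed
  show ?thesis
    using assms * that unfolding is_variant_def by metis
qed

lemma ex_variant_apart:
  assumes "finite V"
  obtains d where "is_variant c d" "clause_vars d \<inter> V = {}"
proof -
  obtain N where N: "\<forall>x\<in>V. x < N"
    using assms finite_nat_set_iff_bounded by blast
  let ?d = "subst_clause c (\<lambda>x. Var (x + N))"
  have "subst_clause ?d (\<lambda>x. Var (x - N)) = c"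
    by (simp add: subst_comp_def)
  then have "is_variant c ?d"
    unfolding is_variant_def by metis
  moreover have "clause_vars ?d \<inter> V = {}"
    using N by (auto simp: clause_vars_subst)
  ultimately show ?thesis using that by blast
qed

section \<open>Satisfaction in a structure\<close>

lemma sat_atom_subst: "sat_atom M v (subst_atom A \<sigma>) = sat_atom M (\<lambda>x. eval_trm M v (\<sigma> x)) A"
  by (simp add: sat_atom_def eval_trm_subst comp_def)

lemma sat_literal_subst:
  "sat_literal M v (subst_literal l \<sigma>) = sat_literal M (\<lambda>x. eval_trm M v (\<sigma> x)) l"
  by (cases l) (simp_all add: sat_atom_subst)

lemma sat_query_subst:
  "sat_query M v (subst_query Q \<sigma>) = sat_query M (\<lambda>x. eval_trm M v (\<sigma> x)) Q"
  by (simp add: sat_query_def sat_literal_subst)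

lemma sat_query_simps [simp]:
  "sat_query M v []"
  "sat_query M v (l # Q) \<longleftrightarrow> sat_literal M v l \<and> sat_query M v Q"
  "sat_query M v (Q @ Q') \<longleftrightarrow> sat_query M v Q \<and> sat_query M v Q'"
  by (auto simp: sat_query_def)

lemma map_eval_cong:
  "(\<And>x. x \<in> atom_vars A \<Longrightarrow> v x = w x) \<Longrightarrow> map (eval_trm M v) (args A) = map (eval_trm M w) (args A)"
  by (auto simp: atom_vars_def intro!: eval_trm_cong)

lemma sat_atom_cong:
  "(\<And>x. x \<in> atom_vars A \<Longrightarrow> v x = w x) \<Longrightarrow> sat_atom M v A = sat_atom M w A"
  unfolding sat_atom_def by (metis map_eval_cong)

lemma sat_literal_cong:
  "(\<And>x. x \<in> atom_vars (atom_of l) \<Longrightarrow> v x = w x) \<Longrightarrow> sat_literal M v l = sat_literal M w l"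
  using sat_atom_cong[of "atom_of l" v w M] by (cases l) simp_all

lemma sat_query_cong:
  "(\<And>x. x \<in> query_vars Q \<Longrightarrow> v x = w x) \<Longrightarrow> sat_query M v Q = sat_query M w Q"
  by (induction Q) (simp_all add: sat_literal_cong[of _ v w])

lemma models_query_subst:
  "is_struct \<L> M \<Longrightarrow> wf_subst \<L> \<sigma> \<Longrightarrow> models_query M Q \<Longrightarrow> models_query M (subst_query Q \<sigma>)"
  by (simp add: models_query_def sat_query_subst eval_subst_valuation)

lemma is_model_clause:
  "is_model \<L> P M \<Longrightarrow> c \<in> P \<Longrightarrow> wf_subst \<L> \<sigma> \<Longrightarrow> v \<in> valuations M \<Longrightarrow>
   sat_query M v (subst_query (body c) \<sigma>) \<Longrightarrow> sat_atom M v (subst_atom (head c) \<sigma>)"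
  unfolding is_model_def sat_query_subst sat_atom_subst by (blast intro: eval_subst_valuation)

section \<open>Unification\<close>

primrec symbol_count :: "'f trm \<Rightarrow> nat" where
  "symbol_count (Var x) = 0"
| "symbol_count (Fun f ts) = Suc (sum_list (map symbol_count ts))"

definition unifies :: "'f subst \<Rightarrow> ('f trm \<times> 'f trm) list \<Rightarrow> bool" where
  "unifies \<sigma> E \<longleftrightarrow> (\<forall>(s, t)\<in>set E. subst_trm s \<sigma> = subst_trm t \<sigma>)"

definition equations_vars :: "('f trm \<times> 'f trm) list \<Rightarrow> nat set" where
  "equations_vars E = (\<Union>(s, t)\<in>set E. trm_vars s \<union> trm_vars t)"

text \<open>The left-hand sides count twice so that turning \<open>f(\<dots>) = x\<close> around decreases the weight.\<close>

definition equations_weight :: "('f trm \<times> 'f trm) list \<Rightarrow> nat" where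
  "equations_weight E = sum_list (map (\<lambda>(s, t). 2 * symbol_count s + symbol_count t) E)"

lemma finite_equations_vars [simp]: "finite (equations_vars E)"
  by (auto simp: equations_vars_def)

lemma equations_simps [simp]:
  "equations_vars ((s, t) # E) = trm_vars s \<union> trm_vars t \<union> equations_vars E"
  "equations_vars (E @ E') = equations_vars E \<union> equations_vars E'"
  "equations_weight ((s, t) # E) = 2 * symbol_count s + symbol_count t + equations_weight E"
  "equations_weight (E @ E') = equations_weight E + equations_weight E'"
  "unifies \<sigma> []"
  "unifies \<sigma> ((s, t) # E) \<longleftrightarrow> subst_trm s \<sigma> = subst_trm t \<sigma> \<and> unifies \<sigma> E"
  "unifies \<sigma> (E @ E') \<longleftrightarrow> unifies \<sigma> E \<and> unifies \<sigma> E'"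
  by (auto simp: equations_vars_def equations_weight_def unifies_def)

lemma unifies_zip:
  "length ss = length ts \<Longrightarrow>
   unifies \<sigma> (zip ss ts) \<longleftrightarrow> map (\<lambda>t. subst_trm t \<sigma>) ss = map (\<lambda>t. subst_trm t \<sigma>) ts"
  by (induction ss ts rule: list_induct2) auto

lemma equations_zip:
  "length ss = length ts \<Longrightarrow>
   equations_weight (zip ss ts) = 2 * sum_list (map symbol_count ss) + sum_list (map symbol_count ts)
   \<and> equations_vars (zip ss ts) = \<Union> (trm_vars ` set ss) \<union> \<Union> (trm_vars ` set ts)"
  by (induction ss ts rule: list_induct2) (auto simp: equations_vars_def equations_weight_def)

lemma is_subst_Var: "is_subst \<L> Var"
  by (simp add: is_subst_def)

lemma is_subst_comp:
  assumes "is_subst \<L> \<sigma>" "is_subst \<L> \<tau>"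
  shows "is_subst \<L> (subst_comp \<sigma> \<tau>)"
proof -
  have "{x. subst_comp \<sigma> \<tau> x \<noteq> Var x} \<subseteq> {x. \<sigma> x \<noteq> Var x} \<union> {x. \<tau> x \<noteq> Var x}"
    by (auto simp: subst_comp_def)
  then show ?thesis
    using assms by (auto simp: is_subst_def subst_comp_def wf_trm_subst intro: finite_subset)
qed

text \<open>Unifiability is derived from a solution in a model of the free equality axioms, and that
  solution factors through the most general unifier just like every unifier does.\<close>

lemma ex_mgu_of_solution:
  fixes M :: "('f, 'r, 'd) struct" and \<L> :: "('f, 'r) language"
  assumes "is_struct \<L> M" "free_equality \<L> M" "v \<in> valuations M"
    and "\<And>s t. (s, t) \<in> set E \<Longrightarrow> wf_trm \<L> s \<and> wf_trm \<L> t \<and> eval_trm M v s = eval_trm M v t"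
  shows "\<exists>\<eta>. is_subst \<L> \<eta> \<and> unifies \<eta> E \<and> (\<forall>\<sigma>. unifies \<sigma> E \<longrightarrow> \<sigma> = subst_comp \<eta> \<sigma>) \<and>
    v = (\<lambda>x. eval_trm M v (\<eta> x))" (is "?mgu E")
  using assms(4)
\<comment> \<open>Eliminating a variable shrinks the variable set; decomposing and turning an
  equation around reduce the weight. Deleting \<open>x = x\<close> may change neither, because
  variables have symbol count 0, so the length comes last.\<close>
proof (induction E rule: wf_induct[OF wf_measures[of "[card \<circ> equations_vars, equations_weight, length]"]])
  case (1 E)
  note sol = 1(2)
  have IH: "?mgu E'"
    if "equations_vars E' \<subset> equations_vars E \<or> equations_vars E' \<subseteq> equations_vars E \<and>
        (equations_weight E' < equations_weight E \<or>
         equations_weight E' = equations_weight E \<and> length E' < length E)"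
      and "\<And>s t. (s, t) \<in> set E' \<Longrightarrow> wf_trm \<L> s \<and> wf_trm \<L> t \<and> eval_trm M v s = eval_trm M v t"
    for E'
  proof -
    have "card (equations_vars E') \<le> card (equations_vars E)"
      using that(1) by (metis card_mono finite_equations_vars psubset_imp_subset)
    moreover have "card (equations_vars E') < card (equations_vars E)"
      if "equations_vars E' \<subset> equations_vars E"
      using that by (simp add: psubset_card_mono)
    ultimately have "(E', E) \<in> measures [card \<circ> equations_vars, equations_weight, length]"
      using that(1) by (simp only: measures_less measures_lesseq in_measures comp_apply) linarith
    then show ?thesis using 1(1) that(2) by blast
  qed
  show ?case
  proof (cases E)
    case Nil
    then show ?thesis by (intro exI[of _ Var]) (simp add: is_subst_Var)
  next
    case (Cons e E\<^sub>0)
    obtain s t where e: "e = (s, t)" by (cases e)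
    note E = Cons[unfolded e]
    have st: "wf_trm \<L> s" "wf_trm \<L> t" "eval_trm M v s = eval_trm M v t"
      using sol[of s t] by (simp_all add: E)
    have sol\<^sub>0: "wf_trm \<L> a \<and> wf_trm \<L> b \<and> eval_trm M v a = eval_trm M v b" if "(a, b) \<in> set E\<^sub>0" for a b
      using sol[of a b] that by (simp add: E)
    show ?thesis
    proof (cases s)
      case s: (Var x)
      show ?thesis
      proof (cases "t = Var x")
        case True
        have "?mgu E\<^sub>0"
          by (rule IH[OF _ sol\<^sub>0]) (auto simp: E s True)
        then show ?thesis by (simp add: E s True)
      next
        case False
        have vx: "v x = eval_trm M v t" using st(3) s by simp
        \<comment> \<open>The occurs check succeeds because \<open>v\<close> solves
          \<open>x = t\<close>, which the third free equality axiom forbids for a proper superterm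
          of \<open>x\<close>.\<close>
        have x: "x \<notin> trm_vars t"
          using assms(2,3) st(2) False vx unfolding free_equality_def by blast
        define \<rho> where "\<rho> = Var(x := t)"
        let ?E = "map (\<lambda>(s, t). (subst_trm s \<rho>, subst_trm t \<rho>)) E\<^sub>0"
        have \<rho>: "is_subst \<L> \<rho>"
          using st(2) by (auto simp: is_subst_def \<rho>_def intro: finite_subset[of _ "{x}"])
        \<comment> \<open>As \<open>v\<close> solves \<open>x = t\<close>, eliminating
          \<open>x\<close> is invisible to it, so \<open>v\<close> also solves the instantiated
          equations.\<close>
        have v\<rho>: "(\<lambda>y. eval_trm M v (\<rho> y)) = v"
          using vx by (auto simp: \<rho>_def)
        have t\<rho>: "subst_trm t \<rho> = t"
          using subst_trm_cong[of t \<rho> Var] x by (metis \<rho>_def fun_upd_other subst_trm_Var)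
        have vars: "trm_vars (subst_trm s \<rho>) \<subseteq> trm_vars s \<union> trm_vars t - {x}" for s
          using x by (auto simp: trm_vars_subst \<rho>_def split: if_splits)
        have "equations_vars ?E \<subseteq> equations_vars E - {x}"
        proof
          fix y assume "y \<in> equations_vars ?E"
          then obtain a b where "(a, b) \<in> set E\<^sub>0"
              "y \<in> trm_vars (subst_trm a \<rho>) \<union> trm_vars (subst_trm b \<rho>)"
            by (auto simp: equations_vars_def)
          moreover from this(1) have "trm_vars a \<union> trm_vars b \<subseteq> equations_vars E\<^sub>0"
            by (auto simp: equations_vars_def)
          ultimately show "y \<in> equations_vars E - {x}"
            using vars[of a] vars[of b] by (auto simp: E)
        qed
        moreover have "x \<in> equations_vars E" by (simp add: E s)
        ultimately have smaller: "equations_vars ?E \<subset> equations_vars E" by auto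
        have "wf_trm \<L> a \<and> wf_trm \<L> b \<and> eval_trm M v a = eval_trm M v b" if "(a, b) \<in> set ?E" for a b
          using that sol\<^sub>0 is_subst_wf_subst[OF \<rho>]
          by (auto simp: eval_trm_subst v\<rho> wf_subst_def intro!: wf_trm_subst)
        then have "?mgu ?E"
          using smaller by (intro IH) blast+
        then obtain \<eta> where \<eta>: "is_subst \<L> \<eta>" "unifies \<eta> ?E"
            "\<And>\<sigma>. unifies \<sigma> ?E \<Longrightarrow> \<sigma> = subst_comp \<eta> \<sigma>" "v = (\<lambda>x. eval_trm M v (\<eta> x))"
          by blast
        have uni: "unifies \<sigma> ?E \<longleftrightarrow> unifies (subst_comp \<rho> \<sigma>) E\<^sub>0" for \<sigma>
          by (auto simp: unifies_def)
        show ?thesis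
        proof (intro exI[of _ "subst_comp \<rho> \<eta>"] conjI allI impI)
          show "is_subst \<L> (subst_comp \<rho> \<eta>)" using \<rho> \<eta>(1) by (rule is_subst_comp)
          have "subst_comp \<rho> \<eta> x = subst_trm t \<eta>" by (simp add: subst_comp_def \<rho>_def)
          moreover have "subst_trm t (subst_comp \<rho> \<eta>) = subst_trm t \<eta>"
            by (metis t\<rho> subst_trm_subst_trm)
          ultimately show "unifies (subst_comp \<rho> \<eta>) E"
            using \<eta>(2) uni by (simp add: E s)
          have "(\<lambda>y. eval_trm M v (subst_comp \<rho> \<eta> y)) = (\<lambda>y. eval_trm M v (\<rho> y))"
            unfolding subst_comp_def eval_trm_subst \<eta>(4)[symmetric] ..
          then show "v = (\<lambda>y. eval_trm M v (subst_comp \<rho> \<eta> y))" using v\<rho> by simp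
          fix \<sigma> assume "unifies \<sigma> E"
          then have \<sigma>: "\<sigma> x = subst_trm t \<sigma>" "unifies \<sigma> E\<^sub>0" by (simp_all add: E s)
          \<comment> \<open>A unifier of \<open>x = t\<close> absorbs the elimination of
            \<open>x\<close>. This keeps the strong form of generality, in which a unifier factors
            through the mgu with itself as the factor.\<close>
          then have \<rho>\<sigma>: "subst_comp \<rho> \<sigma> = \<sigma>"
            by (auto simp: subst_comp_def \<rho>_def)
          then have "unifies \<sigma> ?E" using uni \<sigma>(2) by simp
          from \<eta>(3)[OF this] show "\<sigma> = subst_comp (subst_comp \<rho> \<eta>) \<sigma>"
            using \<rho>\<sigma> by (metis subst_comp_assoc)
        qed
      qed
    next
      case s: (Fun f ss)
      show ?thesis
      proof (cases t)
        case t: (Var x)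
        have "?mgu ((t, s) # E\<^sub>0)"
        proof (rule IH)
          show "wf_trm \<L> a \<and> wf_trm \<L> b \<and> eval_trm M v a = eval_trm M v b"
            if "(a, b) \<in> set ((t, s) # E\<^sub>0)" for a b
            using that sol\<^sub>0[of a b] st by fastforce
        qed (auto simp: E s t)
        then show ?thesis by (simp add: E eq_commute[of "subst_trm t _"])
      next
        case t: (Fun g ts)
        let ?as = "map (eval_trm M v) ss" and ?bs = "map (eval_trm M v) ts"
        have wf: "wf_trm \<L> a" if "a \<in> set ss \<union> set ts" for a
          using that st(1,2) by (auto simp: s t list_all_iff)
        have tup: "?as \<in> tuples M (fun_arity \<L> f)" "?bs \<in> tuples M (fun_arity \<L> g)"
          using st(1,2) wf eval_trm_in_universe[OF assms(1,3)] by (auto simp: s t tuples_def)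
        have eq: "fun_int M f ?as = fun_int M g ?bs"
          using st(3) by (simp add: s t)
        \<comment> \<open>No clash is possible, as distinct function symbols have disjoint ranges in
          \<open>M\<close>; injectivity then makes \<open>v\<close> a solution of the argument
          equations.\<close>
        then have fg: "g = f" using assms(2) tup unfolding free_equality_def by metis
        have args: "?as = ?bs" using assms(2) tup eq unfolding fg free_equality_def by metis
        then have len: "length ss = length ts" by (metis length_map)
        have zip: "eval_trm M v a = eval_trm M v b" if ab: "(a, b) \<in> set (zip ss ts)" for a b
        proof -
          obtain i where "i < length ss" "a = ss ! i" "b = ts ! i"
            using ab by (auto simp: set_zip)
          then show ?thesis using args by (metis len nth_map)
        qed
        have "?mgu (zip ss ts @ E\<^sub>0)"
        proof (rule IH)
          show "wf_trm \<L> a \<and> wf_trm \<L> b \<and> eval_trm M v a = eval_trm M v b"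
            if "(a, b) \<in> set (zip ss ts @ E\<^sub>0)" for a b
            using that sol\<^sub>0[of a b] zip[of a b] wf[of a] wf[of b]
            by (metis UnCI UnE set_append set_zip_leftD set_zip_rightD)
        qed (auto simp: E s t equations_zip[OF len])
        then show ?thesis
          by (simp add: E s t fg unifies_zip[OF len])
      qed
    qed
  qed
qed

section \<open>Resolvents\<close>

text \<open>A variant apart from \<open>Q @ Q\<^sub>2\<close> is apart from \<open>Q\<close>, so the
  same variant and mgu resolve \<open>Q\<close> alone: steps of a query project to steps of its
  prefix. The substitution \<open>\<delta>\<close> is the renaming followed by the mgu, so that the
  clause itself appears instead of its variant.\<close>

lemma clause_resolvent_appendE:
  assumes "clause_resolvent \<L> c (Q @ Q\<^sub>2) Q'" "Q \<noteq> []"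
  obtains A Ls \<delta> \<theta> where "Q = Pos A # Ls" "wf_subst \<L> \<delta>" "wf_subst \<L> \<theta>"
    "subst_atom A \<theta> = subst_atom (head c) \<delta>"
    "clause_resolvent \<L> c Q (subst_query (body c) \<delta> @ subst_query Ls \<theta>)"
    "Q' = (subst_query (body c) \<delta> @ subst_query Ls \<theta>) @ subst_query Q\<^sub>2 \<theta>"
proof -
  obtain A Ls' d \<theta> where *: "Q @ Q\<^sub>2 = Pos A # Ls'" "is_variant c d"
      "clause_vars d \<inter> query_vars (Q @ Q\<^sub>2) = {}" "is_mgu \<L> \<theta> A (head d)"
      "Q' = subst_query (body d @ Ls') \<theta>"
    using assms(1) unfolding clause_resolvent_def by blast
  obtain Ls where Q: "Q = Pos A # Ls" "Ls' = Ls @ Q\<^sub>2"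
    using *(1) assms(2) by (cases Q) auto
  obtain \<sigma> where \<sigma>: "wf_subst \<L> \<sigma>" "d = subst_clause c \<sigma>"
    using *(2) by (rule is_variantE)
  have \<theta>: "wf_subst \<L> \<theta>" "subst_atom A \<theta> = subst_atom (head d) \<theta>"
    using *(4) by (auto simp: is_mgu_def is_unifier_def is_subst_wf_subst)
  have "clause_vars d \<inter> query_vars Q = {}" using *(3) by auto
  then have "clause_resolvent \<L> c Q (subst_query (body d @ Ls) \<theta>)"
    unfolding clause_resolvent_def using Q(1) *(2,4) by blast
  then show ?thesis
    using that[of A Ls "subst_comp \<sigma> \<theta>" \<theta>] Q \<sigma> \<theta> *(5) by (simp add: wf_subst_comp)
qed

lemma clause_resolventE:
  assumes "clause_resolvent \<L> c Q Q'"
  obtains A Ls \<delta> \<theta> where "Q = Pos A # Ls" "wf_subst \<L> \<delta>" "wf_subst \<L> \<theta>"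
    "subst_atom A \<theta> = subst_atom (head c) \<delta>"
    "Q' = subst_query (body c) \<delta> @ subst_query Ls \<theta>"
proof -
  have "Q \<noteq> []" using assms by (auto simp: clause_resolvent_def)
  then show ?thesis
    using that assms clause_resolvent_appendE[of \<L> c Q "[]" Q'] by (metis append_Nil2 subst_query_simps(1))
qed

lemma wf_query_clause_resolvent:
  assumes "clause_resolvent \<L> c Q Q'" "wf_clause \<L> c" "wf_query \<L> Q"
  shows "wf_query \<L> Q'"
  using assms(1)
  by (rule clause_resolventE)
    (use assms(2,3) in \<open>auto simp: wf_clause_def wf_subst_def intro!: wf_query_subst\<close>)

text \<open>The semantic core of soundness of failure: a solution of the query survives in a
  resolvent. The second claim covers every choice of variant and mgu, because a tree contains just
  one arbitrary resolvent per applicable clause.\<close>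

lemma resolvent_of_solution:
  fixes M :: "('f, 'r, 'd) struct" and \<L> :: "('f, 'r) language"
  assumes M: "is_struct \<L> M" "free_equality \<L> M"
    and wf: "wf_query \<L> (Pos A # Ls)" "wf_clause \<L> c"
    and rel: "rel (head c) = rel A"
    and v: "v \<in> valuations M" "sat_query M v Ls"
    and w: "w \<in> valuations M" "sat_query M w (body c)"
    and eq: "map (eval_trm M v) (args A) = map (eval_trm M w) (args (head c))"
  shows "\<exists>Q'. clause_resolvent \<L> c (Pos A # Ls) Q'"
    and "clause_resolvent \<L> c (Pos A # Ls) Q' \<Longrightarrow> \<exists>u\<in>valuations M. sat_query M u Q'"
proof -
  have key: "\<exists>u \<eta>. u \<in> valuations M \<and> is_mgu \<L> \<eta> A (head d) \<and> u = (\<lambda>x. eval_trm M u (\<eta> x)) \<and>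
      sat_query M u (body d @ Ls)"
    if d: "is_variant c d" "clause_vars d \<inter> query_vars (Pos A # Ls) = {}" for d
  proof -
    obtain \<sigma> \<tau> where st: "wf_subst \<L> \<sigma>" "wf_subst \<L> \<tau>" "d = subst_clause c \<sigma>" "c = subst_clause d \<tau>"
      using d(1) by (rule is_variantE)
    \<comment> \<open>Variables of the variant are read in \<open>w\<close> through the inverse
      renaming, all others in \<open>v\<close>. As the variant is apart from the query, the two
      readings do not interfere.\<close>
    define u where "u x = (if x \<in> clause_vars d then eval_trm M w (\<tau> x) else v x)" for x
    have u: "u \<in> valuations M"
      using v(1) eval_subst_valuation[OF M(1) w(1) st(2)] by (simp add: valuations_def u_def)
    have "map (eval_trm M u) (args A) = map (eval_trm M v) (args A)"
      using d(2) by (intro map_eval_cong) (auto simp: u_def)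
    also have "\<dots> = map (eval_trm M (\<lambda>x. eval_trm M w (\<tau> x))) (args (head d))"
      unfolding eq by (subst st(4)) (simp add: eval_trm_subst comp_def)
    also have "\<dots> = map (eval_trm M u) (args (head d))"
      by (intro map_eval_cong) (simp add: u_def clause_vars_def)
    finally have eq': "map (eval_trm M u) (args A) = map (eval_trm M u) (args (head d))" .
    have "sat_query M (\<lambda>x. eval_trm M w (\<tau> x)) (body d)"
      using w(2) by (subst (asm) st(4)) (simp add: sat_query_subst)
    moreover have "sat_query M (\<lambda>x. eval_trm M w (\<tau> x)) (body d) = sat_query M u (body d)"
      by (intro sat_query_cong) (simp add: u_def clause_vars_def)
    moreover have "sat_query M u Ls = sat_query M v Ls"
      using d(2) by (intro sat_query_cong) (auto simp: u_def)
    ultimately have sat: "sat_query M u (body d @ Ls)"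
      using v(2) by simp
    let ?E = "zip (args A) (args (head d))"
    have len: "length (args A) = length (args (head d))"
      using eq' by (metis length_map)
    have wfd: "wf_atom \<L> (head d)"
      using wf(2) st(1) by (auto simp: st(3) wf_clause_def wf_subst_def intro!: wf_atom_subst)
    have "wf_trm \<L> a \<and> wf_trm \<L> b \<and> eval_trm M u a = eval_trm M u b" if ab: "(a, b) \<in> set ?E" for a b
    proof -
      obtain i where i: "i < length (args A)" "a = args A ! i" "b = args (head d) ! i"
        using ab by (auto simp: set_zip)
      then have "eval_trm M u a = eval_trm M u b" using eq' len by (metis nth_map)
      then show ?thesis using i wf(1) wfd len by (auto simp: wf_atom_def)
    qed
    from ex_mgu_of_solution[OF M u this] obtain \<eta> where \<eta>: "is_subst \<L> \<eta>" "unifies \<eta> ?E"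
        "\<And>\<sigma>. unifies \<sigma> ?E \<Longrightarrow> \<sigma> = subst_comp \<eta> \<sigma>" "u = (\<lambda>x. eval_trm M u (\<eta> x))"
      by blast
    have "rel (head d) = rel A" using rel st(3) by simp
    then have uni: "is_unifier \<L> \<sigma> A (head d) \<longleftrightarrow> is_subst \<L> \<sigma> \<and> unifies \<sigma> ?E" for \<sigma>
      by (simp add: is_unifier_def unifies_zip[OF len] subst_atom_def)
    \<comment> \<open>Each unifier is its own factor through \<open>\<eta>\<close>, so the factor is
      again a substitution with finite support.\<close>
    have "is_mgu \<L> \<eta> A (head d)"
      unfolding is_mgu_def uni using \<eta>(1-3) unfolding subst_comp_def by blast
    then show ?thesis using u \<eta>(4) sat by blast
  qed
  show "\<exists>Q'. clause_resolvent \<L> c (Pos A # Ls) Q'"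
  proof -
    obtain d where d: "is_variant c d" "clause_vars d \<inter> query_vars (Pos A # Ls) = {}"
      using ex_variant_apart finite_query_vars by blast
    from key[OF this] d show ?thesis unfolding clause_resolvent_def by blast
  qed
  show "\<exists>u\<in>valuations M. sat_query M u Q'" if res: "clause_resolvent \<L> c (Pos A # Ls) Q'"
  proof -
    obtain d \<theta> where d: "is_variant c d" "clause_vars d \<inter> query_vars (Pos A # Ls) = {}"
        "is_mgu \<L> \<theta> A (head d)" "Q' = subst_query (body d @ Ls) \<theta>"
      using res unfolding clause_resolvent_def by blast
    obtain u \<eta> where u: "u \<in> valuations M" "is_mgu \<L> \<eta> A (head d)" "u = (\<lambda>x. eval_trm M u (\<eta> x))"
        "sat_query M u (body d @ Ls)"
      using key[OF d(1,2)] by blast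
    \<comment> \<open>The given resolvent was formed with its own mgu \<open>\<theta>\<close>,
      through which \<open>\<eta>\<close> factors. Reading \<open>\<gamma>\<close> in
      \<open>u\<close> yields a valuation under which \<open>\<theta>\<close> evaluates to
      \<open>u\<close>.\<close>
    obtain \<gamma> where \<gamma>: "is_subst \<L> \<gamma>" "\<eta> = subst_comp \<theta> \<gamma>"
      using d(3) u(2) unfolding is_mgu_def subst_comp_def by blast
    let ?u = "\<lambda>x. eval_trm M u (\<gamma> x)"
    have "(\<lambda>x. eval_trm M ?u (\<theta> x)) = u"
      by (subst (2) u(3)) (simp add: \<gamma>(2) subst_comp_def eval_trm_subst)
    then have "sat_query M ?u Q'"
      using u(4) by (simp add: d(4) sat_query_subst flip: subst_query_simps(3))
    then show ?thesis
      using eval_subst_valuation[OF M(1) u(1)] \<gamma>(1) is_subst_wf_subst by blast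
  qed
qed

section \<open>Soundness of LDNF-resolution\<close>

lemma neg_star_body:
  assumes "c \<in> P" "rel (head c) \<in> neg_star P" "l \<in> set (body c)"
  shows "rel (atom_of l) \<in> neg_star P"
proof -
  have "(rel (head c), rel (atom_of l)) \<in> refers_to P"
    using assms(1,3) by (auto simp: refers_to_def)
  then show ?thesis
    using assms(2) unfolding neg_star_def depends_on_def by (auto intro: rtrancl_into_rtrancl)
qed

lemma neg_star_negative_literal: "c \<in> P \<Longrightarrow> Neg A \<in> set (body c) \<Longrightarrow> rel A \<in> neg_star P"
  unfolding neg_star_def neg_rels_def depends_on_def by blast

text \<open>Applied with \<open>N\<close> being \<open>neg_star P\<close> and with \<open>N\<close>
  being the complement of \<open>defined_rels P\<close>.\<close>

lemma query_rels_clause_resolvent: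
  assumes "clause_resolvent \<L> c Q Q'" "\<forall>l\<in>set Q. rel (atom_of l) \<in> N"
    and "rel (head c) \<in> N \<Longrightarrow> \<forall>l\<in>set (body c). rel (atom_of l) \<in> N"
  shows "\<forall>l\<in>set Q'. rel (atom_of l) \<in> N"
proof -
  obtain A Ls \<delta> \<theta> where *: "Q = Pos A # Ls" "subst_atom A \<theta> = subst_atom (head c) \<delta>"
      "Q' = subst_query (body c) \<delta> @ subst_query Ls \<theta>"
    using assms(1) by (rule clause_resolventE)
  have "rel A = rel (head c)" using *(2) by (metis rel_subst_atom)
  then show ?thesis using assms(2,3) *(1,3) by auto
qed

lemma ground_sat_atom: "ground_atom A \<Longrightarrow> sat_atom M v A = sat_atom M w A"
  by (rule sat_atom_cong) (simp add: ground_atom_def)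

text \<open>Failure and success are treated together because a negative literal exchanges them.
  Failure rests on the only-if half of the completion, hence the restriction to
  \<open>neg_star P\<close>. For success, satisfiability is strong enough: the root of a subsidiary
  tree is ground, so one valuation decides its truth.\<close>

lemma ldnf_tree_sound:
  assumes "general_program \<L> P" "complete_model \<L> P M" "is_ldnf_tree \<L> P T"
    and "wf_query \<L> (root T)" "\<forall>l\<in>set (root T). rel (atom_of l) \<in> neg_star P"
  shows "(finitely_failed T \<longrightarrow> (\<forall>v\<in>valuations M. \<not> sat_query M v (root T))) \<and>
    (has_successful_branch T \<longrightarrow> (\<exists>v\<in>valuations M. sat_query M v (root T)))"
  using assms(3-)
proof (induction rule: is_ldnf_tree.induct)
  case empty
  obtain d where "d \<in> universe M"
    using assms(2) by (auto simp: complete_model_def is_model_def is_struct_def)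
  then have "(\<lambda>_. d) \<in> valuations M"
    by (simp add: valuations_def)
  then show ?case by (auto simp: failed_leaf_def)
next
  case (pos cs A Ls Ts)
  let ?Q = "Pos A # Ls"
  have model: "is_model \<L> P M" and struct: "is_struct \<L> M" "free_equality \<L> M"
    and compl: "\<And>p ds. p \<in> neg_star P \<Longrightarrow> ds \<in> tuples M (rel_arity \<L> p) \<Longrightarrow>
        rel_int M p ds \<Longrightarrow> \<exists>c\<in>neg_part P. rel (head c) = p \<and>
           (\<exists>v\<in>valuations M. ds = map (eval_trm M v) (args (head c)) \<and> sat_query M v (body c))"
    using assms(2) unfolding complete_model_def is_model_of_completion_def is_model_def by blast+
  have wf: "wf_clause \<L> c" if "c \<in> P" for c
    using that assms(1) by (simp add: general_program_def)
  have Q: "wf_query \<L> ?Q" "\<forall>l\<in>set ?Q. rel (atom_of l) \<in> neg_star P"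
    using pos.prems by simp_all
  have len: "length cs = length Ts" using pos(3) by (rule list_all2_lengthD)
  have child: "c \<in> P \<and> clause_resolvent \<L> c ?Q (root T) \<and>
      (finitely_failed T \<longrightarrow> (\<forall>v\<in>valuations M. \<not> sat_query M v (root T))) \<and>
      (has_successful_branch T \<longrightarrow> (\<exists>v\<in>valuations M. sat_query M v (root T)))"
    if i: "i < length Ts" "c = cs ! i" "T = Ts ! i" for i c T
  proof -
    have c: "c \<in> P" using pos(2) i len by (metis (mono_tags, lifting) mem_Collect_eq nth_mem)
    have T: "clause_resolvent \<L> c ?Q (root T)"
      "wf_query \<L> (root T) \<Longrightarrow> \<forall>l\<in>set (root T). rel (atom_of l) \<in> neg_star P \<Longrightarrow>
       (finitely_failed T \<longrightarrow> (\<forall>v\<in>valuations M. \<not> sat_query M v (root T))) \<and>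
       (has_successful_branch T \<longrightarrow> (\<exists>v\<in>valuations M. sat_query M v (root T)))"
      using list_all2_nthD2[OF pos(3) i(1)] i(2,3) by blast+
    have "\<forall>l\<in>set (root T). rel (atom_of l) \<in> neg_star P"
      using query_rels_clause_resolvent[OF T(1) Q(2)] neg_star_body[OF c] by blast
    then show ?thesis
      using c T wf_query_clause_resolvent[OF T(1) wf[OF c] Q(1)] by blast
  qed
  have "\<not> sat_query M v ?Q" if ff: "finitely_failed (Node ?Q None Ts)" and v: "v \<in> valuations M" for v
  proof
    assume sat: "sat_query M v ?Q"
    let ?ds = "map (eval_trm M v) (args A)"
    have "?ds \<in> tuples M (rel_arity \<L> (rel A))"
      using Q(1) eval_trm_in_universe[OF struct(1) v] by (auto simp: tuples_def wf_atom_def)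
    moreover have "rel_int M (rel A) ?ds" using sat by (simp add: sat_atom_def)
    moreover have "rel A \<in> neg_star P" using Q(2) by simp
    ultimately obtain c w where c: "c \<in> neg_part P" "rel (head c) = rel A" "w \<in> valuations M"
        "?ds = map (eval_trm M w) (args (head c))" "sat_query M w (body c)"
      using compl by blast
    have cP: "c \<in> P" using c(1) by (simp add: neg_part_def)
    have "sat_query M v Ls" using sat by simp
    note sol = resolvent_of_solution[OF struct Q(1) wf[OF cP] c(2) v this c(3,5,4)]
    \<comment> \<open>The clause was found semantically, through the completion; unifiability shows
      that it labels a child. That child is finitely failed, yet its query is satisfiable.\<close>
    have "c \<in> set cs" using sol(1) cP pos(2) by blast
    then obtain i where i: "i < length Ts" "c = cs ! i" using len by (metis in_set_conv_nth)
    then have "finitely_failed (Ts ! i)" using ff by (auto split: if_splits)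
    then show False using child[OF i refl] sol(2) by blast
  qed
  moreover have "\<exists>v\<in>valuations M. sat_query M v ?Q" if succ: "has_successful_branch (Node ?Q None Ts)"
  proof -
    obtain i where i: "i < length Ts" "has_successful_branch (Ts ! i)"
      using succ by (auto simp: in_set_conv_nth)
    note ch = child[OF i(1) refl refl]
    obtain v where v: "v \<in> valuations M" "sat_query M v (root (Ts ! i))"
      using ch i(2) by blast
    obtain \<delta> \<theta> where *: "wf_subst \<L> \<delta>" "wf_subst \<L> \<theta>" "subst_atom A \<theta> = subst_atom (head (cs ! i)) \<delta>"
        "root (Ts ! i) = subst_query (body (cs ! i)) \<delta> @ subst_query Ls \<theta>"
      using ch by (blast elim: clause_resolventE)
    have "sat_atom M v (subst_atom A \<theta>)"
      using is_model_clause[OF model _ *(1) v(1)] ch v(2) *(3,4) by simp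
    then have "sat_query M v (subst_query ?Q \<theta>)" using v(2) *(4) by simp
    then show ?thesis
      using eval_subst_valuation[OF struct(1) v(1) *(2)] unfolding sat_query_subst by blast
  qed
  ultimately show ?case unfolding ldnf_tree.sel by blast
next
  case (neg_resolvent A S T Ls)
  have "\<forall>v\<in>valuations M. \<not> sat_query M v (root S)"
    using neg_resolvent by simp
  then show ?case using neg_resolvent by (auto simp: ex_in_conv)
next
  case (neg_no_resolvent A S Ls)
  have "has_successful_branch S \<longrightarrow> (\<exists>v\<in>valuations M. sat_query M v (root S))"
    using neg_no_resolvent by simp
  then show ?case
    using neg_no_resolvent.hyps ground_sat_atom[of A M]
    by (auto simp: failed_leaf_def)
next
  case (floundered A Ls)
  then show ?case by (simp add: failed_leaf_def)
qed

section \<open>Modes\<close>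

text \<open>\<open>V\<close> collects the variables already produced. Queries start from the empty
  set and clause bodies from the head's input variables, so one notion serves both and splits along
  concatenation.\<close>

fun well_moded_from :: "'r moding \<Rightarrow> nat set \<Rightarrow> ('f, 'r) query \<Rightarrow> bool" where
  "well_moded_from m V [] \<longleftrightarrow> True"
| "well_moded_from m V (l # Q) \<longleftrightarrow>
     vars_at m Input (atom_of l) \<subseteq> V \<and> well_moded_from m (V \<union> vars_at m Output (atom_of l)) Q"

definition output_vars :: "'r moding \<Rightarrow> ('f, 'r) query \<Rightarrow> nat set" where
  "output_vars m Q = (\<Union>l\<in>set Q. vars_at m Output (atom_of l))"

lemma output_vars_simps [simp]:
  "output_vars m [] = {}"
  "output_vars m (l # Q) = vars_at m Output (atom_of l) \<union> output_vars m Q"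
  "output_vars m (Q @ Q') = output_vars m Q \<union> output_vars m Q'"
  by (auto simp: output_vars_def)

lemma well_moded_from_iff:
  "well_moded_from m V Q \<longleftrightarrow> (\<forall>i<length Q. vars_at m Input (atom_of (Q ! i)) \<subseteq>
     V \<union> (\<Union>j<i. vars_at m Output (atom_of (Q ! j))))"
proof (induction Q arbitrary: V)
  case (Cons l Q)
  have "(\<Union>j<Suc i. vars_at m Output (atom_of ((l # Q) ! j))) =
      vars_at m Output (atom_of l) \<union> (\<Union>j<i. vars_at m Output (atom_of (Q ! j)))" for i
    by (simp add: lessThan_Suc_eq_insert_0)
  then show ?case
    by (simp add: Cons.IH All_less_Suc2 Un_assoc)
qed simp

lemma well_moded_query_iff: "well_moded_query m Q \<longleftrightarrow> well_moded_from m {} Q"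
  by (simp add: well_moded_query_def well_moded_from_iff)

lemma output_vars_nth: "output_vars m Q = (\<Union>j<length Q. vars_at m Output (atom_of (Q ! j)))"
  unfolding output_vars_def set_conv_nth by blast

lemma well_moded_clause_iff:
  "well_moded_clause m c \<longleftrightarrow> well_moded_from m (vars_at m Input (head c)) (body c) \<and>
     vars_at m Output (head c) \<subseteq> vars_at m Input (head c) \<union> output_vars m (body c)"
  by (simp add: well_moded_clause_def well_moded_from_iff output_vars_nth)

lemma well_moded_from_append [simp]:
  "well_moded_from m V (Q @ Q') \<longleftrightarrow>
   well_moded_from m V Q \<and> well_moded_from m (V \<union> output_vars m Q) Q'"
  by (induction Q arbitrary: V) (auto simp: Un_assoc)

lemma well_moded_from_mono: "well_moded_from m V Q \<Longrightarrow> V \<subseteq> W \<Longrightarrow> well_moded_from m W Q"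
proof (induction Q arbitrary: V W)
  case (Cons l Q)
  have "V \<union> vars_at m Output (atom_of l) \<subseteq> W \<union> vars_at m Output (atom_of l)"
    using Cons.prems(2) by blast
  then show ?case using Cons by auto
qed simp

lemma terms_at_subst: "terms_at m d (subst_atom A \<sigma>) = map (\<lambda>t. subst_trm t \<sigma>) (terms_at m d A)"
  by (auto simp: terms_at_def)

lemma vars_at_subst: "vars_at m d (subst_atom A \<sigma>) = (\<Union>x\<in>vars_at m d A. trm_vars (\<sigma> x))"
  by (auto simp: vars_at_def terms_at_subst trm_vars_subst)

lemma vars_at_subset: "vars_at m d A \<subseteq> atom_vars A"
  by (force simp: vars_at_def terms_at_def atom_vars_def)

lemma output_vars_subst: "output_vars m (subst_query Q \<sigma>) = (\<Union>x\<in>output_vars m Q. trm_vars (\<sigma> x))"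
  by (auto simp: output_vars_def vars_at_subst)

lemma terms_at_subst_ground:
  "vars_at m d A = {} \<Longrightarrow> terms_at m d (subst_atom A \<sigma>) = terms_at m d A"
  unfolding terms_at_subst vars_at_def
  by (rule map_idI) (metis (no_types, lifting) SUP_bot_conv(1) empty_iff subst_trm_Var subst_trm_cong)

lemma well_moded_from_subst:
  "well_moded_from m V Q \<Longrightarrow> well_moded_from m (\<Union>x\<in>V. trm_vars (\<sigma> x)) (subst_query Q \<sigma>)"
proof (induction Q arbitrary: V)
  case (Cons l Q)
  then show ?case
    using Cons.IH[of "V \<union> vars_at m Output (atom_of l)"]
    by (auto simp: vars_at_subst UN_Un)
qed simp

text \<open>The selected atom has ground inputs, so unification grounds the head's inputs and the
  body instance needs nothing from outside. What the rest of the query consumed from the atom's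
  outputs is now produced by the body.\<close>

lemma well_moded_clause_resolvent:
  assumes "clause_resolvent \<L> c Q Q'" "well_moded_clause m c" "well_moded_from m {} Q"
  shows "well_moded_from m {} Q'"
proof -
  obtain A Ls \<delta> \<theta> where *: "Q = Pos A # Ls" "subst_atom A \<theta> = subst_atom (head c) \<delta>"
      "Q' = subst_query (body c) \<delta> @ subst_query Ls \<theta>"
    using assms(1) by (rule clause_resolventE)
  let ?V = "\<lambda>\<sigma> V. \<Union>x\<in>V. trm_vars (\<sigma> x)"
  have A: "vars_at m Input A = {}" "well_moded_from m (vars_at m Output A) Ls"
    using assms(3) *(1) by auto
  have head: "?V \<theta> (vars_at m d A) = ?V \<delta> (vars_at m d (head c))" for d
    using *(2) by (metis vars_at_subst)
  have inp: "?V \<delta> (vars_at m Input (head c)) = {}" using head[of Input] A(1) by simp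
  have "well_moded_from m {} (subst_query (body c) \<delta>)"
    using well_moded_from_subst[of m _ "body c" \<delta>] assms(2) inp by (metis well_moded_clause_iff)
  moreover have "?V \<delta> (vars_at m Output (head c)) \<subseteq>
      ?V \<delta> (vars_at m Input (head c)) \<union> ?V \<delta> (output_vars m (body c))"
    using assms(2) unfolding well_moded_clause_iff by blast
  then have "?V \<theta> (vars_at m Output A) \<subseteq> output_vars m (subst_query (body c) \<delta>)"
    using inp head[of Output] by (simp add: output_vars_subst)
  then have "well_moded_from m (output_vars m (subst_query (body c) \<delta>)) (subst_query Ls \<theta>)"
    using well_moded_from_subst[OF A(2), of \<theta>] well_moded_from_mono by blast
  ultimately show ?thesis by (simp add: *(3))
qed

section \<open>Termination\<close>

text \<open>Accessibility for the converse of \<open>ldnf_step\<close>, which provides induction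
  along derivations.\<close>

inductive terminating :: "('f, 'r) language \<Rightarrow> ('f, 'r) program \<Rightarrow> ('f, 'r) query \<Rightarrow> bool"
  for \<L> P where
  terminatingI: "(\<And>Q'. ldnf_step \<L> P Q Q' \<Longrightarrow> terminating \<L> P Q') \<Longrightarrow> terminating \<L> P Q"

lemma all_ldnf_derivations_finite_iff: "all_ldnf_derivations_finite \<L> P Q \<longleftrightarrow> terminating \<L> P Q"
proof
  assume fin: "all_ldnf_derivations_finite \<L> P Q"
  show "terminating \<L> P Q"
  proof (rule ccontr)
    assume non: "\<not> terminating \<L> P Q"
    have "\<exists>q. \<forall>k. (\<not> terminating \<L> P (q k) \<and> (k = 0 \<longrightarrow> q k = Q)) \<and> ldnf_step \<L> P (q k) (q (Suc k))"
    proof (rule dependent_nat_choice)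
      show "\<exists>x. \<not> terminating \<L> P x \<and> (0 = 0 \<longrightarrow> x = Q)" using non by blast
      show "\<exists>y. (\<not> terminating \<L> P y \<and> (Suc k = 0 \<longrightarrow> y = Q)) \<and> ldnf_step \<L> P x y"
        if "\<not> terminating \<L> P x \<and> (k = 0 \<longrightarrow> x = Q)" for x :: "('a, 'b) query" and k :: nat
        using that terminatingI[of \<L> P x] by blast
    qed
    then show False using fin unfolding all_ldnf_derivations_finite_def by blast
  qed
next
  have "\<forall>q. q 0 = Q \<longrightarrow> \<not> (\<forall>k. ldnf_step \<L> P (q k) (q (Suc k)))" if "terminating \<L> P Q"
    using that
  proof (induction rule: terminating.induct)
    case (terminatingI Q)
    show ?case
    proof (intro allI impI notI)
      fix q assume q: "q 0 = Q" "\<forall>k. ldnf_step \<L> P (q k) (q (Suc k))"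
      then have "ldnf_step \<L> P Q (q (Suc 0))" by blast
      then show False using terminatingI.IH[of "q (Suc 0)"] q(2)
        by (auto dest!: spec[of _ "\<lambda>k. q (Suc k)"])
    qed
  qed
  then show "all_ldnf_derivations_finite \<L> P Q" if "terminating \<L> P Q"
    using that unfolding all_ldnf_derivations_finite_def by blast
qed

lemma terminating_Nil: "terminating \<L> P []"
  by (rule terminatingI) (auto elim!: ldnf_step.cases resolvent.cases simp: clause_resolvent_def)

text \<open>A step from \<open>[Neg A]\<close> leads to the empty query or to
  \<open>[Pos A]\<close>.\<close>

lemma terminating_Neg:
  assumes "terminating \<L> P [Pos A]"
  shows "terminating \<L> P [Neg A]"
  by (rule terminatingI)
    (auto elim!: ldnf_step.cases resolvent.cases simp: clause_resolvent_def assms terminating_Nil)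

text \<open>The continuation \<open>Q\<^sub>2\<close> is only ever entered under a substitution that makes the resolved
  prefix \<open>Q\<close> true in \<open>M\<close>, up to the negative literals of an initial query about which the
  completion says nothing.\<close>

lemma terminating_append:
  assumes P: "general_program \<L> P" "well_moded_program m P" "complete_model \<L> P M"
    and "terminating \<L> P Q" "wf_query \<L> (Q @ Q\<^sub>2)" "well_moded_from m {} (Q @ Q\<^sub>2)"
    and "\<And>\<theta>. wf_subst \<L> \<theta> \<Longrightarrow> well_moded_from m {} (subst_query Q\<^sub>2 \<theta>) \<Longrightarrow>
      (\<And>l. l \<in> set Q \<Longrightarrow> (\<And>A. l = Neg A \<Longrightarrow> rel A \<in> neg_star P) \<Longrightarrow>
         models_query M [subst_literal l \<theta>]) \<Longrightarrow>
      terminating \<L> P (subst_query Q\<^sub>2 \<theta>)"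
  shows "terminating \<L> P (Q @ Q\<^sub>2)"
  using assms(4-)
proof (induction arbitrary: Q\<^sub>2 rule: terminating.induct)
  case (terminatingI Q)
  note IH = terminatingI.IH
  note wf = terminatingI.prems(1) and wm = terminatingI.prems(2) and cont = terminatingI.prems(3)
  have model: "is_model \<L> P M" and struct: "is_struct \<L> M"
    using P(3) by (auto simp: complete_model_def is_model_def)
  show ?case
  proof (cases "Q = []")
    case True
    then show ?thesis using cont[of Var] wm by simp
  next
    case False
    show ?thesis
    proof (rule terminating.terminatingI)
      fix Q' assume "ldnf_step \<L> P (Q @ Q\<^sub>2) Q'"
      then show "terminating \<L> P Q'"
      proof cases
        case resolve
        then show ?thesis
        proof cases
          case (pos c)
          obtain A Ls \<delta> \<theta> where Q: "Q = Pos A # Ls" "wf_subst \<L> \<delta>" "wf_subst \<L> \<theta>"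
            "subst_atom A \<theta> = subst_atom (head c) \<delta>"
            "clause_resolvent \<L> c Q (subst_query (body c) \<delta> @ subst_query Ls \<theta>)"
            "Q' = (subst_query (body c) \<delta> @ subst_query Ls \<theta>) @ subst_query Q\<^sub>2 \<theta>"
            using clause_resolvent_appendE[OF pos(2) False] .
          show ?thesis
            unfolding Q(6)
          proof (rule IH)
            show "ldnf_step \<L> P Q (subst_query (body c) \<delta> @ subst_query Ls \<theta>)"
              using Q(5) pos(1) ldnf_step.resolve resolvent.pos by metis
            have "wf_clause \<L> c" "well_moded_clause m c"
              using P(1,2) pos(1) by (simp_all add: general_program_def well_moded_program_def)
            then show "wf_query \<L> ((subst_query (body c) \<delta> @ subst_query Ls \<theta>) @ subst_query Q\<^sub>2 \<theta>)"
              and "well_moded_from m {} ((subst_query (body c) \<delta> @ subst_query Ls \<theta>) @ subst_query Q\<^sub>2 \<theta>)"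
              using wf_query_clause_resolvent[OF pos(2)] well_moded_clause_resolvent[OF pos(2)] wf wm
              unfolding Q(6) by blast+
          next
            fix \<rho>
            assume \<rho>: "wf_subst \<L> \<rho>" "well_moded_from m {} (subst_query (subst_query Q\<^sub>2 \<theta>) \<rho>)"
              and sound: "\<And>l. l \<in> set (subst_query (body c) \<delta> @ subst_query Ls \<theta>) \<Longrightarrow>
                (\<And>A. l = Neg A \<Longrightarrow> rel A \<in> neg_star P) \<Longrightarrow> models_query M [subst_literal l \<rho>]"
            \<comment> \<open>A relation negated in a clause of the program lies in
              \<open>neg_star P\<close>, so body literals always meet the side condition of
              \<open>sound\<close>.\<close>
            have bod: "models_query M [subst_literal l (subst_comp \<delta> \<rho>)]" if l: "l \<in> set (body c)" for l
            proof -
              have "models_query M [subst_literal (subst_literal l \<delta>) \<rho>]"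
              proof (rule sound)
                fix A assume "subst_literal l \<delta> = Neg A"
                then obtain B where "l = Neg B" "rel B = rel A" using subst_literal_eq_NegD by metis
                then show "rel A \<in> neg_star P"
                  using l pos(1) neg_star_negative_literal by metis
              qed (simp add: l)
              then show ?thesis by simp
            qed
            \<comment> \<open>With the body instance true, the model makes the head instance true,
              and unification identifies it with the instance of the selected atom.\<close>
            have "models_query M [Pos (subst_atom A (subst_comp \<theta> \<rho>))]"
              unfolding models_query_def
            proof
              fix v assume v: "v \<in> valuations M"
              then have "sat_query M v (subst_query (body c) (subst_comp \<delta> \<rho>))"
                using bod unfolding models_query_def sat_query_def set_subst_query by auto
              from is_model_clause[OF model pos(1) wf_subst_comp[OF Q(2) \<rho>(1)] v this]
              have "sat_atom M v (subst_atom (subst_atom A \<theta>) \<rho>)" unfolding Q(4) by simp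
              then show "sat_query M v [Pos (subst_atom A (subst_comp \<theta> \<rho>))]" by simp
            qed
            moreover have "models_query M [subst_literal l (subst_comp \<theta> \<rho>)]"
              if l: "l \<in> set Ls" "\<And>A. l = Neg A \<Longrightarrow> rel A \<in> neg_star P" for l
            proof -
              have "models_query M [subst_literal (subst_literal l \<theta>) \<rho>]"
                using l by (intro sound) (auto, cases l, auto)
              then show ?thesis by simp
            qed
            ultimately have "terminating \<L> P (subst_query Q\<^sub>2 (subst_comp \<theta> \<rho>))"
              using \<rho>(2) by (intro cont) (auto simp: Q(1) wf_subst_comp[OF Q(3) \<rho>(1)])
            then show "terminating \<L> P (subst_query (subst_query Q\<^sub>2 \<theta>) \<rho>)" by simp
          qed
        next
          case (neg A S)
          obtain L where Q: "Q = Neg A # L" "Q' = L @ Q\<^sub>2"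
            using neg(1) False by (cases Q) auto
          show ?thesis
            unfolding Q(2)
          proof (rule IH)
            show "ldnf_step \<L> P Q L"
              unfolding Q(1) using neg resolvent.neg ldnf_step.resolve by metis
            show "wf_query \<L> (L @ Q\<^sub>2)" using wf by (simp add: Q(1))
            \<comment> \<open>A ground literal produces no variables, so dropping it preserves
              well-modedness.\<close>
            have "vars_at m Output A = {}"
              using vars_at_subset[of m Output A] neg(2) by (simp add: ground_atom_def)
            then show "well_moded_from m {} (L @ Q\<^sub>2)" using wm by (simp add: Q(1))
          next
            fix \<theta>
            assume \<theta>: "wf_subst \<L> \<theta>" "well_moded_from m {} (subst_query Q\<^sub>2 \<theta>)"
              and sound: "\<And>l. l \<in> set L \<Longrightarrow> (\<And>A. l = Neg A \<Longrightarrow> rel A \<in> neg_star P) \<Longrightarrow>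
                models_query M [subst_literal l \<theta>]"
            have "models_query M [subst_literal (Neg A) \<theta>]" if "rel A \<in> neg_star P"
              using ldnf_tree_sound[OF P(1,3) neg(3)] neg(4,5) that wf
              by (auto simp: Q(1) models_query_def ground_atom_subst[OF neg(2)])
            then show "terminating \<L> P (subst_query Q\<^sub>2 \<theta>)"
              using sound by (intro cont \<theta>) (auto simp: Q(1))
          qed
        qed
      next
        case (subsidiary A Ls)
        then obtain L where "Q = Neg A # L" using False by (cases Q) auto
        \<comment> \<open>The subsidiary root forgets the rest of the query, so this is already a
          step of the prefix.\<close>
        then have "ldnf_step \<L> P Q Q'"
          using subsidiary ldnf_step.subsidiary by metis
        then show ?thesis by (rule terminatingI.hyps)
      qed
    qed
  qed
qed

section \<open>Queries over relations not defined in \<open>P\<close>\<close>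

lemma extension_clause_resolvent:
  assumes "extends P R" "c \<in> P \<union> R" "clause_resolvent \<L> c Q Q'"
    and "\<forall>l\<in>set Q. rel (atom_of l) \<notin> defined_rels P"
  shows "c \<in> R" "\<forall>l\<in>set Q'. rel (atom_of l) \<notin> defined_rels P"
proof -
  obtain A Ls \<delta> \<theta> where *: "Q = Pos A # Ls" "subst_atom A \<theta> = subst_atom (head c) \<delta>"
    using assms(3) by (rule clause_resolventE)
  have "rel (head c) = rel A" using *(2) by (metis rel_subst_atom)
  then have "rel (head c) \<notin> defined_rels P" using assms(4) *(1) by simp
  then show c: "c \<in> R" using assms(2) by (auto simp: defined_rels_def)
  have "rel (atom_of l) \<in> rels R" if "l \<in> set (body c)" for l
    using c that by (force simp: rels_def clause_rels_def)
  then have "\<forall>l\<in>set (body c). rel (atom_of l) \<in> - defined_rels P"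
    using assms(1) by (auto simp: extends_def)
  then show "\<forall>l\<in>set Q'. rel (atom_of l) \<notin> defined_rels P"
    using query_rels_clause_resolvent[OF assms(3), of "- defined_rels P"] assms(4) by simp
qed

text \<open>A negative step over \<open>P \<union> R\<close> is justified by a tree over the whole
  program, whereas the hypothesis on \<open>R\<close> concerns trees over \<open>R\<close>; hence
  trees have to be transferred before steps.\<close>

lemma extension_ldnf_tree:
  assumes "extends P R" "is_ldnf_tree \<L> (P \<union> R) T"
    and "\<forall>l\<in>set (root T). rel (atom_of l) \<notin> defined_rels P"
  shows "is_ldnf_tree \<L> R T"
  using assms(2,3)
proof (induction rule: is_ldnf_tree.induct)
  case (pos cs A Ls Ts)
  have rels: "\<forall>l\<in>set (Pos A # Ls). rel (atom_of l) \<notin> defined_rels P"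
    using pos.prems by simp
  note ext = extension_clause_resolvent[OF assms(1) _ _ rels]
  have "set cs = {c \<in> R. \<exists>Q'. clause_resolvent \<L> c (Pos A # Ls) Q'}"
    using pos(2) ext(1) by blast
  moreover have "list_all2 (\<lambda>c T. clause_resolvent \<L> c (Pos A # Ls) (root T) \<and> is_ldnf_tree \<L> R T) cs Ts"
    by (rule list.rel_mono_strong[OF pos(3)]) (use pos(2) ext(2) in blast)
  ultimately show ?case using pos(1) by (intro is_ldnf_tree.pos)
qed (auto intro: is_ldnf_tree.intros)

lemma extension_ldnf_step:
  assumes "extends P R" "ldnf_step \<L> (P \<union> R) Q Q'"
    and "\<forall>l\<in>set Q. rel (atom_of l) \<notin> defined_rels P"
  shows "ldnf_step \<L> R Q Q' \<and> (\<forall>l\<in>set Q'. rel (atom_of l) \<notin> defined_rels P)"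
  using assms(2)
proof cases
  case resolve
  then show ?thesis
  proof cases
    case (pos c)
    from extension_clause_resolvent[OF assms(1) pos assms(3)] pos(2) show ?thesis
      by (blast intro: ldnf_step.resolve resolvent.pos)
  next
    case (neg A S)
    then have "is_ldnf_tree \<L> R S"
      using extension_ldnf_tree[OF assms(1)] assms(3) by simp
    then show ?thesis
      using neg assms(3) ldnf_step.resolve resolvent.neg by (metis list.set_intros(2))
  qed
next
  case (subsidiary A Ls)
  then show ?thesis using assms(3) by (auto intro: ldnf_step.subsidiary)
qed

lemma extension_terminating:
  assumes "extends P R" "terminating \<L> R Q" "\<forall>l\<in>set Q. rel (atom_of l) \<notin> defined_rels P"
  shows "terminating \<L> (P \<union> R) Q"
  using assms(2,3)
proof (induction rule: terminating.induct)
  case (terminatingI Q)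
  show ?case
    by (rule terminating.terminatingI)
      (use terminatingI extension_ldnf_step[OF assms(1)] in blast)
qed

section \<open>Ground instances and descent along the level mapping\<close>

lemma ground_instanceI:
  assumes "c \<in> P" "wf_subst \<L> \<sigma>" "clause_vars (subst_clause c \<sigma>) = {}"
  shows "subst_clause c \<sigma> \<in> ground_instances \<L> P"
proof -
  \<comment> \<open>A grounding by one constant has infinite support. The identity outside the
    clause restores the finite support that \<open>is_subst\<close> demands.\<close>
  let ?\<sigma> = "\<lambda>x. if x \<in> clause_vars c then \<sigma> x else Var x"
  have "is_subst \<L> ?\<sigma>"
    using assms(2) by (auto simp: is_subst_def wf_subst_def intro: finite_subset[of _ "clause_vars c"])
  moreover have "subst_clause c \<sigma> = subst_clause c ?\<sigma>"
    by (rule subst_clause_cong) simp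
  ultimately show ?thesis
    using assms(1,3) unfolding ground_instances_def by fastforce
qed

locale acceptable_extension =
  fixes \<L> :: "('f, 'r) language" and m :: "'r moding" and P R :: "('f, 'r) program"
    and M :: "('f, 'r, 'd) struct" and lev :: "('f, 'r) atom \<Rightarrow> nat"
  assumes constant_symbol: "has_constant \<L>"
    and program: "general_program \<L> (P \<union> R)"
    and well_moded: "well_moded_program m (P \<union> R)"
    and extends: "extends P R"
    and complete: "complete_model \<L> (P \<union> R) M"
    and moded: "moded_level_mapping \<L> m P lev"
    and acceptable: "acceptable \<L> P lev M"
    and base: "\<And>Q. \<lbrakk>wf_query \<L> Q; well_moded_from m {} Q\<rbrakk> \<Longrightarrow> terminating \<L> R Q"
begin

text \<open>Levels are meaningful only for ground atoms, but outputs of a selected atom may contain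
  variables. A constant fills them in, and modedness makes the level independent of this
  choice.\<close>

lemma ex_grounding:
  obtains \<gamma> where "wf_subst \<L> \<gamma>" "\<And>x. trm_vars (\<gamma> x) = {}"
proof -
  obtain k where "fun_arity \<L> k = 0" using constant_symbol by (auto simp: has_constant_def)
  then show ?thesis using that[of "\<lambda>_. Fun k []"] by (simp add: wf_subst_def)
qed

text \<open>The induction is on the level of the instances of \<open>A\<close>, which is determined by the ground
  input terms of \<open>A\<close>; \<open>B\<close> is any such instance.\<close>

lemma terminating_defined_atom:
  assumes "wf_atom \<L> A" "vars_at m Input A = {}" "rel A \<in> defined_rels P"
    and "B \<in> herbrand_base \<L> P" "rel B = rel A" "terms_at m Input B = terms_at m Input A"
  shows "terminating \<L> (P \<union> R) [Pos A]"
  using assms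
proof (induction "lev B" arbitrary: A B rule: less_induct)
  case less
  have struct: "is_struct \<L> M" using complete by (simp add: complete_model_def is_model_def)
  have groundB: "ground_atom B" using less.prems(4) by (simp add: herbrand_base_def)
  have inpB: "terms_at m Input (subst_atom B \<sigma>) = terms_at m Input B" for \<sigma>
    using groundB by (simp add: ground_atom_subst)
  show ?case
  proof (rule terminating.terminatingI)
    fix Q' assume "ldnf_step \<L> (P \<union> R) [Pos A] Q'"
    then obtain c where c: "c \<in> P \<union> R" "clause_resolvent \<L> c [Pos A] Q'"
      by (auto elim!: ldnf_step.cases resolvent.cases)
    obtain \<delta> \<theta> where Q': "wf_subst \<L> \<delta>" "subst_atom A \<theta> = subst_atom (head c) \<delta>"
        "Q' = subst_query (body c) \<delta>"
      using c(2) by (auto elim!: clause_resolventE)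
    have rel_head: "rel (head c) = rel A" using Q'(2) by (metis rel_subst_atom)
    have "c \<notin> R"
      using less.prems(3) extends by (auto simp: extends_def rels_def clause_rels_def rel_head[symmetric])
    then have cP: "c \<in> P" using c(1) by blast
    have wfc: "wf_clause \<L> c" and wmc: "well_moded_clause m c"
      using c(1) program well_moded by (auto simp: general_program_def well_moded_program_def)
    \<comment> \<open>Invariant of a run through the body: \<open>As\<close> is the part already
      solved and true in \<open>M\<close>, and the head still has the input terms of
      \<open>B\<close>. Outputs may become instantiated, but the level bound stays the same.\<close>
    have suffix: "terminating \<L> (P \<union> R) Bs"
      if "wf_subst \<L> \<sigma>" "subst_query (body c) \<sigma> = As @ Bs" "well_moded_from m {} Bs"
        "models_query M As" "terms_at m Input (subst_atom (head c) \<sigma>) = terms_at m Input B"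
      for \<sigma> As Bs
      using that
    proof (induction "length Bs" arbitrary: \<sigma> As Bs)
      case 0
      then show ?case by (simp add: terminating_Nil)
    next
      case (Suc n)
      note \<sigma> = Suc.prems(1) and bod = Suc.prems(2) and wmBs = Suc.prems(3)
        and As = Suc.prems(4) and inp = Suc.prems(5)
      obtain b Bs' where Bs: "Bs = b # Bs'" using Suc(2) by (cases Bs) auto
      have "wf_query \<L> (As @ Bs)"
        using wfc \<sigma> unfolding bod[symmetric] by (auto simp: wf_clause_def wf_subst_def intro: wf_query_subst)
      then have wfBs: "wf_query \<L> Bs" by simp
      have b: "wf_atom \<L> (atom_of b)" "vars_at m Input (atom_of b) = {}"
        using wfBs wmBs by (simp_all add: Bs)
      have "terminating \<L> (P \<union> R) [Pos (atom_of b)]"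
      proof (cases "rel (atom_of b) \<in> defined_rels P")
        case True
        \<comment> \<open>Acceptability needs a ground clause; \<open>As\<close> stays true in
          \<open>M\<close> under the grounding because it holds for all valuations.\<close>
        obtain \<gamma> where \<gamma>: "wf_subst \<L> \<gamma>" "\<And>x. trm_vars (\<gamma> x) = {}" by (rule ex_grounding) blast
        let ?c = "subst_clause c (subst_comp \<sigma> \<gamma>)"
        let ?b = "subst_atom (atom_of b) \<gamma>"
        have "clause_vars ?c = {}"
          by (simp add: \<gamma>(2) clause_vars_subst subst_comp_def trm_vars_subst)
        then have gi: "?c \<in> ground_instances \<L> P"
          using cP \<sigma> \<gamma>(1) by (intro ground_instanceI wf_subst_comp)
        have "body ?c = subst_query (subst_query (body c) \<sigma>) \<gamma>" by simp
        also have "\<dots> = subst_query As \<gamma> @ subst_literal b \<gamma> # subst_query Bs' \<gamma>"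
          unfolding bod Bs by simp
        finally have "lev ?b < lev (head ?c)"
          using acceptable gi models_query_subst[OF struct \<gamma>(1) As]
          unfolding acceptable_def by (metis atom_of_subst)
        moreover have "head ?c \<in> herbrand_base \<L> P"
          using wfc cP \<open>clause_vars ?c = {}\<close> wf_subst_comp[OF \<sigma> \<gamma>(1)]
          by (auto simp: herbrand_base_def ground_atom_def clause_vars_def rels_def clause_rels_def
              wf_clause_def wf_subst_def intro!: wf_atom_subst)
        moreover have "terms_at m Input (head ?c) = terms_at m Input B"
        proof -
          have "terms_at m Input (head ?c) =
              map (\<lambda>t. subst_trm t \<gamma>) (terms_at m Input (subst_atom (head c) \<sigma>))"
            unfolding terms_at_subst[symmetric] by simp
          also have "\<dots> = terms_at m Input (subst_atom B \<gamma>)"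
            unfolding inp by (simp only: terms_at_subst)
          finally show ?thesis by (simp only: inpB)
        qed
        \<comment> \<open>The ground head and \<open>B\<close> may differ in their outputs only, so
          a moded level mapping gives them the same level.\<close>
        ultimately have "lev ?b < lev B"
          using moded less.prems(4,5) rel_head unfolding moded_level_mapping_def
          by (metis rel_subst_atom subst_clause_sel(1))
        moreover have "?b \<in> herbrand_base \<L> P"
          using b(1) True \<gamma>
          by (auto simp: herbrand_base_def ground_atom_def atom_vars_subst rels_def clause_rels_def
              defined_rels_def wf_subst_def intro!: wf_atom_subst)
        ultimately show ?thesis
          using less.hyps[of ?b "atom_of b"] b True terms_at_subst_ground[OF b(2)] by simp
      next
        case False
        then show ?thesis
          using b base by (intro extension_terminating[OF extends]) simp_all
      qed
      then have "terminating \<L> (P \<union> R) [b]"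
        by (cases b) (simp_all add: terminating_Neg)
      then have "terminating \<L> (P \<union> R) ([b] @ Bs')"
      proof (rule terminating_append[OF program well_moded complete])
        show "wf_query \<L> ([b] @ Bs')" "well_moded_from m {} ([b] @ Bs')"
          using wfBs wmBs by (simp_all add: Bs)
        fix \<theta>
        assume \<theta>: "wf_subst \<L> \<theta>" "well_moded_from m {} (subst_query Bs' \<theta>)"
          and sound: "\<And>l. l \<in> set [b] \<Longrightarrow> (\<And>A. l = Neg A \<Longrightarrow> rel A \<in> neg_star (P \<union> R)) \<Longrightarrow>
            models_query M [subst_literal l \<theta>]"
        \<comment> \<open>The literal just solved joins the true prefix. If it is negative, it stems
          from a clause body, so its relation lies in
          \<open>neg_star (P \<union> R)\<close>.\<close>
        have "models_query M [subst_literal b \<theta>]"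
        proof (rule sound)
          fix A' assume A': "b = Neg A'"
          have "b \<in> set (subst_query (body c) \<sigma>)" by (simp add: bod Bs)
          then obtain l where l: "l \<in> set (body c)" "b = subst_literal l \<sigma>" by auto
          then obtain A'' where "l = Neg A''" "rel A'' = rel A'"
            using A' subst_literal_eq_NegD by metis
          then show "rel A' \<in> neg_star (P \<union> R)"
            using l(1) c(1) neg_star_negative_literal by metis
        qed simp
        then have "models_query M (subst_query As \<theta> @ [subst_literal b \<theta>])"
          using models_query_subst[OF struct \<theta>(1) As] by (simp add: models_query_def)
        moreover have "subst_query (body c) (subst_comp \<sigma> \<theta>) =
            (subst_query As \<theta> @ [subst_literal b \<theta>]) @ subst_query Bs' \<theta>"
          using bod by (simp add: Bs flip: subst_query_subst_query)
        moreover have "terms_at m Input (subst_atom (head c) (subst_comp \<sigma> \<theta>)) = terms_at m Input B"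
          by (simp only: terms_at_subst[of _ _ _ \<theta>] inp flip: subst_atom_subst_atom)
            (simp only: inpB flip: terms_at_subst)
        moreover have "n = length (subst_query Bs' \<theta>)" using Suc(2) Bs by simp
        ultimately show "terminating \<L> (P \<union> R) (subst_query Bs' \<theta>)"
          using Suc(1) wf_subst_comp[OF \<sigma> \<theta>(1)] \<theta>(2) by blast
      qed
      then show ?case by (simp add: Bs)
    qed
    have "well_moded_from m {} Q'"
      using well_moded_clause_resolvent[OF c(2) wmc] less.prems(2) by simp
    moreover have "terms_at m Input (subst_atom (head c) \<delta>) = terms_at m Input B"
      using terms_at_subst_ground[OF less.prems(2)] less.prems(6) by (metis Q'(2))
    ultimately show "terminating \<L> (P \<union> R) Q'"
      using Q'(1,3) by (intro suffix[of \<delta> "[]"]) (simp_all add: models_query_def)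
  qed
qed

lemma terminating_literal:
  assumes "wf_atom \<L> (atom_of l)" "vars_at m Input (atom_of l) = {}"
  shows "terminating \<L> (P \<union> R) [l]"
proof -
  let ?A = "atom_of l"
  have "terminating \<L> (P \<union> R) [Pos ?A]"
  proof (cases "rel ?A \<in> defined_rels P")
    case True
    obtain \<gamma> where \<gamma>: "wf_subst \<L> \<gamma>" "\<And>x. trm_vars (\<gamma> x) = {}" by (rule ex_grounding) blast
    \<comment> \<open>Any ground instance can serve as the representative whose level starts the
      descent.\<close>
    have "subst_atom ?A \<gamma> \<in> herbrand_base \<L> P"
      using assms(1) True \<gamma>
      by (auto simp: herbrand_base_def ground_atom_def atom_vars_subst rels_def clause_rels_def
          defined_rels_def wf_subst_def intro!: wf_atom_subst)
    then show ?thesis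
      using terminating_defined_atom[OF assms True] terms_at_subst_ground[OF assms(2)] by simp
  next
    case False
    then show ?thesis
      using assms base by (intro extension_terminating[OF extends]) simp_all
  qed
  then show ?thesis by (cases l) (simp_all add: terminating_Neg)
qed

text \<open>Every literal reached has ground inputs and terminates on its own, whatever its truth
  value in \<open>M\<close>. Negative literals of the initial query outside
  \<open>neg_star (P \<union> R)\<close> are thus harmless.\<close>

lemma terminating_query:
  assumes "wf_query \<L> Q" "well_moded_from m {} Q"
  shows "terminating \<L> (P \<union> R) Q"
  using assms
proof (induction "length Q" arbitrary: Q)
  case 0
  then show ?case by (simp add: terminating_Nil)
next
  case (Suc n)
  obtain l Q\<^sub>2 where Q: "Q = l # Q\<^sub>2" using Suc(2) by (cases Q) auto
  have "terminating \<L> (P \<union> R) ([l] @ Q\<^sub>2)"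
  proof (rule terminating_append[OF program well_moded complete])
    show "terminating \<L> (P \<union> R) [l]"
      using Suc.prems by (intro terminating_literal) (simp_all add: Q)
    show "wf_query \<L> ([l] @ Q\<^sub>2)" "well_moded_from m {} ([l] @ Q\<^sub>2)"
      using Suc.prems by (simp_all add: Q)
    fix \<theta> assume "wf_subst \<L> \<theta>" "well_moded_from m {} (subst_query Q\<^sub>2 \<theta>)"
    moreover from this(1) have "wf_query \<L> (subst_query Q\<^sub>2 \<theta>)"
      using Suc.prems(1) by (auto simp: Q wf_subst_def intro!: wf_query_subst)
    ultimately show "terminating \<L> (P \<union> R) (subst_query Q\<^sub>2 \<theta>)"
      using Suc(1,2) by (simp add: Q)
  qed
  then show ?case by (simp add: Q)
qed

end

theorem corollary34:
  fixes \<L> :: "('f, 'r) language"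
    and m :: "'r moding"
    and P R :: "('f, 'r) program"
    and M :: "('f, 'r, 'd) struct"
    and lev :: "('f, 'r) atom \<Rightarrow> nat"
  assumes "has_constant \<L>"
    and "general_program \<L> P"
    and "general_program \<L> R"
    and "well_moded_program m (P \<union> R)"
    and "extends P R"
    and "complete_model \<L> (P \<union> R) M"
    and "moded_level_mapping \<L> m P lev"
    and "acceptable \<L> P lev M"
    and "\<And>Q. \<lbrakk>wf_query \<L> Q; well_moded_query m Q\<rbrakk> \<Longrightarrow> all_ldnf_derivations_finite \<L> R Q"
  shows "\<forall>Q. wf_query \<L> Q \<and> well_moded_query m Q \<longrightarrow> all_ldnf_derivations_finite \<L> (P \<union> R) Q"
proof -
  interpret acceptable_extension \<L> m P R M lev
  proof
    show "general_program \<L> (P \<union> R)"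
      using assms(2,3) by (auto simp: general_program_def)
  qed (use assms in \<open>simp_all add: all_ldnf_derivations_finite_iff well_moded_query_iff\<close>)
  show ?thesis
    by (simp add: all_ldnf_derivations_finite_iff well_moded_query_iff terminating_query)
qed

end
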